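(* There is an algorithm for the Linear Function Ranking problem that runs in time polynomial in $m$, $n$ and $D_{max}$ and whose expected testing cost is within a factor $O(\log(mD_{max}))$ of optimal, where $D_{max}=\max_{j\in\{1,\dots,m\}}\sum_{i=1}^n|a_{j_i}|$.
   Context: Linear Function Ranking: input is $m$ linear functions $f_j(x)=a_{j_1}x_1+\dots+a_{j_n}x_n$ ($j=1,\dots,m$) with integer coefficients, a probability vector $p\in(0,1)^n$, and costs $c_i\ge0$. An unknown $x\in\{0,1\}^n$ is drawn from the product distribution with $\Pr[x_i=1]=p_i$; $x_i$ can be learned only by testing $i$ at cost $c_i$. A strategy adaptively tests variables and must eventually output a permutation $(j_1,\dots,j_m)$ of $\{1,\dots,m\}$ that is known definitively to satisfy $f_{j_1}(x)\le f_{j_2}(x)\le\dots\le f_{j_m}(x)$, i.e. this ordering holds for every $x'\in\{0,1\}^n$ agreeing with the observed test outcomes. Its cost is the expected total testing cost for $x$ drawn from the distribution; an optimal strategy minimizes it. *)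

theory Defs
  imports "HOL-Probability.Probability"
begin

section \<open>Linear Function Ranking\<close>

text \<open>Functions and variables are numbered from 0: the functions are \<open>0, \<dots>, num_funs I - 1\<close> and the
  variables are \<open>0, \<dots>, num_vars I - 1\<close>. A hidden assignment is a map \<open>nat \<Rightarrow> bool\<close> of which only the
  first \<open>num_vars I\<close> values matter.\<close>

record lfr =
  num_funs :: nat
  num_vars :: nat
  coeff :: "nat \<Rightarrow> nat \<Rightarrow> int"
  prob_one :: "nat \<Rightarrow> real"
  test_cost :: "nat \<Rightarrow> real"

definition lfr_instance :: "lfr \<Rightarrow> bool" where
  "lfr_instance I \<longleftrightarrow> 1 \<le> num_funs I \<and>
     (\<forall>i<num_vars I. 0 < prob_one I i \<and> prob_one I i < 1 \<and> 0 \<le> test_cost I i)"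

definition lin_fun :: "lfr \<Rightarrow> nat \<Rightarrow> (nat \<Rightarrow> bool) \<Rightarrow> int" where
  "lin_fun I j x = (\<Sum>i<num_vars I. coeff I j i * of_bool (x i))"

definition D_max :: "lfr \<Rightarrow> nat" where
  "D_max I = Max ((\<lambda>j. \<Sum>i<num_vars I. nat \<bar>coeff I j i\<bar>) ` {..<num_funs I})"

definition assignment_pmf :: "lfr \<Rightarrow> (nat \<Rightarrow> bool) pmf" where
  "assignment_pmf I = Pi_pmf {..<num_vars I} False (\<lambda>i. bernoulli_pmf (prob_one I i))"

subsection \<open>Strategies\<close>

text \<open>In \<open>Test i S0 S1\<close> the strategy continues with \<open>S0\<close> if variable \<open>i\<close> turns out to be 0 and with
  \<open>S1\<close> if it turns out to be 1.\<close>

datatype strategy = Output "nat list" | Test nat strategy strategy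

fun tests :: "strategy \<Rightarrow> (nat \<Rightarrow> bool) \<Rightarrow> nat list" where
  "tests (Output js) x = []"
| "tests (Test i S0 S1) x = i # tests (if x i then S1 else S0) x"

fun answer :: "strategy \<Rightarrow> (nat \<Rightarrow> bool) \<Rightarrow> nat list" where
  "answer (Output js) x = js"
| "answer (Test i S0 S1) x = answer (if x i then S1 else S0) x"

definition known_ranking :: "lfr \<Rightarrow> nat set \<Rightarrow> (nat \<Rightarrow> bool) \<Rightarrow> nat list \<Rightarrow> bool" where
  "known_ranking I T x js \<longleftrightarrow> distinct js \<and> set js = {..<num_funs I} \<and>
     (\<forall>x'. (\<forall>i\<in>T. x' i = x i) \<longrightarrow> sorted (map (\<lambda>j. lin_fun I j x') js))"

definition ranking_strategy :: "lfr \<Rightarrow> strategy \<Rightarrow> bool" where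
  "ranking_strategy I S \<longleftrightarrow> (\<forall>x. set (tests S x) \<subseteq> {..<num_vars I} \<and>
     known_ranking I (set (tests S x)) x (answer S x))"

definition expected_cost :: "lfr \<Rightarrow> strategy \<Rightarrow> real" where
  "expected_cost I S =
     measure_pmf.expectation (assignment_pmf I) (\<lambda>x. \<Sum>i\<leftarrow>tests S x. test_cost I i)"

definition opt_cost :: "lfr \<Rightarrow> real" where
  "opt_cost I = Inf (expected_cost I ` {S. ranking_strategy I S})"

text \<open>The infimum is over a nonempty set that is bounded below.\<close>

primrec full_strategy :: "lfr \<Rightarrow> nat \<Rightarrow> (nat \<Rightarrow> bool) \<Rightarrow> strategy" where
  "full_strategy I 0 y = Output (sort_key (\<lambda>j. lin_fun I j y) [0..<num_funs I])"
| "full_strategy I (Suc k) y =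
     Test k (full_strategy I k (y(k := False))) (full_strategy I k (y(k := True)))"

lemma tests_full: "set (tests (full_strategy I k y) x) = {..<k}"
  by (induction k arbitrary: y) (auto simp: lessThan_Suc)

lemma answer_full:
  "answer (full_strategy I k y) x =
     sort_key (\<lambda>j. lin_fun I j (\<lambda>i. if i < k then x i else y i)) [0..<num_funs I]"
proof (induction k arbitrary: y)
  case (Suc k)
  have "(\<lambda>i. if i < k then x i else (y(k := b)) i) = (\<lambda>i. if i < Suc k then x i else y i)"
    if "b = x k" for b
    using that by (auto simp: fun_eq_iff less_Suc_eq)
  then show ?case by (cases "x k") (simp_all only: answer.simps full_strategy.simps Suc.IH if_True if_False)
qed simp

lemma ranking_strategy_full: "ranking_strategy I (full_strategy I (num_vars I) y)"
proof -
  have "lin_fun I j (\<lambda>i. if i < num_vars I then x i else y i) = lin_fun I j x'"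
    if "\<forall>i\<in>{..<num_vars I}. x' i = x i" for j x x'
    using that by (simp add: lin_fun_def)
  then show ?thesis
    unfolding ranking_strategy_def known_ranking_def tests_full answer_full
    by (simp add: atLeast0LessThan)
qed

lemma expected_cost_nonneg:
  assumes "lfr_instance I" "ranking_strategy I S"
  shows "0 \<le> expected_cost I S"
  unfolding expected_cost_def
  using assms by (intro Bochner_Integration.integral_nonneg sum_list_nonneg)
    (auto simp: lfr_instance_def ranking_strategy_def)

lemma opt_cost_le:
  assumes "lfr_instance I" "ranking_strategy I S"
  shows "opt_cost I \<le> expected_cost I S"
  unfolding opt_cost_def
  using assms expected_cost_nonneg by (intro cINF_lower bdd_belowI2[where m = 0]) auto

section \<open>Interactive real RAM\<close>

text \<open>The running time has to be bounded independently of the real numbers \<open>prob_one\<close> and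
  \<open>test_cost\<close>, so the model of computation is the real RAM, given as a while language: unit-cost
  field operations and comparisons on reals, no rounding of reals to integers, and separate integer
  memory, which alone can be used for addressing. Integers can only be added, subtracted and
  compared, so unit cost does not hide superpolynomial bit operations on them. The command \<open>Query\<close>
  is the only access to the hidden assignment.

  Memory consists of named arrays; a scalar variable is an array used at index 0.\<close>

datatype iexp = IConst int | ICell string iexp | IAdd iexp iexp | ISub iexp iexp

datatype rexp = ROfInt iexp | RCell string iexp
  | RAdd rexp rexp | RSub rexp rexp | RMul rexp rexp | RDiv rexp rexp

datatype bexp = ILess iexp iexp | RLess rexp rexp | BNot bexp | BAnd bexp bexp

datatype com = Skip
  | IAssign string iexp iexp
  | RAssign string iexp rexp
  | Query string iexp iexp
  | Seq com com
  | Cond bexp com com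
  | While bexp com

record state =
  imem :: "string \<Rightarrow> int \<Rightarrow> int"
  rmem :: "string \<Rightarrow> int \<Rightarrow> real"

fun ival :: "iexp \<Rightarrow> state \<Rightarrow> int" where
  "ival (IConst k) s = k"
| "ival (ICell v e) s = imem s v (ival e s)"
| "ival (IAdd e1 e2) s = ival e1 s + ival e2 s"
| "ival (ISub e1 e2) s = ival e1 s - ival e2 s"

fun rval :: "rexp \<Rightarrow> state \<Rightarrow> real" where
  "rval (ROfInt e) s = of_int (ival e s)"
| "rval (RCell v e) s = rmem s v (ival e s)"
| "rval (RAdd e1 e2) s = rval e1 s + rval e2 s"
| "rval (RSub e1 e2) s = rval e1 s - rval e2 s"
| "rval (RMul e1 e2) s = rval e1 s * rval e2 s"
| "rval (RDiv e1 e2) s = rval e1 s / rval e2 s"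

fun bval :: "bexp \<Rightarrow> state \<Rightarrow> bool" where
  "bval (ILess e1 e2) s \<longleftrightarrow> ival e1 s < ival e2 s"
| "bval (RLess e1 e2) s \<longleftrightarrow> rval e1 s < rval e2 s"
| "bval (BNot b) s \<longleftrightarrow> \<not> bval b s"
| "bval (BAnd b1 b2) s \<longleftrightarrow> bval b1 s \<and> bval b2 s"

definition iupd :: "string \<Rightarrow> int \<Rightarrow> int \<Rightarrow> state \<Rightarrow> state" where
  "iupd v k z s = s\<lparr>imem := (imem s)(v := (imem s v)(k := z))\<rparr>"

definition rupd :: "string \<Rightarrow> int \<Rightarrow> real \<Rightarrow> state \<Rightarrow> state" where
  "rupd v k r s = s\<lparr>rmem := (rmem s)(v := (rmem s v)(k := r))\<rparr>"

text \<open>\<open>exec x P s t is s'\<close>: on the hidden assignment \<open>x\<close>, program \<open>P\<close> started in \<open>s\<close> halts in \<open>s'\<close> after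
  \<open>t\<close> steps, having tested the variables \<open>is\<close> in this order. Every assignment, test and branching
  counts as one step; the expressions of a fixed program have bounded size, so charging for each
  single operation would change the time by at most a constant factor.\<close>

inductive exec :: "(nat \<Rightarrow> bool) \<Rightarrow> com \<Rightarrow> state \<Rightarrow> nat \<Rightarrow> nat list \<Rightarrow> state \<Rightarrow> bool" for x where
  Skip: "exec x Skip s 1 [] s"
| IAssign: "exec x (IAssign v e1 e2) s 1 [] (iupd v (ival e1 s) (ival e2 s) s)"
| RAssign: "exec x (RAssign v e1 e2) s 1 [] (rupd v (ival e1 s) (rval e2 s) s)"
| Query: "ival e2 s = int i \<Longrightarrow>
    exec x (Query v e1 e2) s 1 [i] (iupd v (ival e1 s) (of_bool (x i)) s)"
| Seq: "exec x P s1 t1 is1 s2 \<Longrightarrow> exec x Q s2 t2 is2 s3 \<Longrightarrow>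
    exec x (Seq P Q) s1 (t1 + t2) (is1 @ is2) s3"
| CondTrue: "bval b s \<Longrightarrow> exec x P s t is s' \<Longrightarrow> exec x (Cond b P Q) s (t + 1) is s'"
| CondFalse: "\<not> bval b s \<Longrightarrow> exec x Q s t is s' \<Longrightarrow> exec x (Cond b P Q) s (t + 1) is s'"
| WhileFalse: "\<not> bval b s \<Longrightarrow> exec x (While b P) s 1 [] s"
| WhileTrue: "bval b s1 \<Longrightarrow> exec x P s1 t1 is1 s2 \<Longrightarrow> exec x (While b P) s2 t2 is2 s3 \<Longrightarrow>
    exec x (While b P) s1 (t1 + t2 + 1) (is1 @ is2) s3"

lemma exec_deterministic:
  "exec x P s t is s' \<Longrightarrow> exec x P s u js s'' \<Longrightarrow> t = u \<and> is = js \<and> s' = s''"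
proof (induction arbitrary: u js s'' rule: exec.induct)
  case (Seq P s1 t1 is1 s2 Q t2 is2 s3)
  from Seq.prems Seq.IH show ?case by (cases rule: exec.cases) blast+
next
  case (WhileTrue b s1 P t1 is1 s2 t2 is2 s3)
  from WhileTrue.prems WhileTrue.IH WhileTrue.hyps show ?case by (cases rule: exec.cases) blast+
qed (erule exec.cases; fastforce)+

text \<open>The coefficient matrix is stored row by row; all cells not holding input are 0.\<close>

definition input_state :: "lfr \<Rightarrow> state" where
  "input_state I =
     \<lparr>imem = (\<lambda>v k.
        if v = ''m'' \<and> k = 0 then int (num_funs I)
        else if v = ''n'' \<and> k = 0 then int (num_vars I)
        else if v = ''a'' \<and> 0 \<le> k \<and> k < int (num_funs I * num_vars I)
          then coeff I (nat k div num_vars I) (nat k mod num_vars I)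
        else 0),
      rmem = (\<lambda>v k.
        if v = ''p'' \<and> 0 \<le> k \<and> k < int (num_vars I) then prob_one I (nat k)
        else if v = ''c'' \<and> 0 \<le> k \<and> k < int (num_vars I) then test_cost I (nat k)
        else 0)\<rparr>"

definition output_of :: "lfr \<Rightarrow> state \<Rightarrow> int list" where
  "output_of I s = map (\<lambda>k. imem s ''out'' (int k)) [0..<num_funs I]"

text \<open>The time bound \<open>T\<close> covers the whole interaction, from the input state to the output of the
  permutation.\<close>

definition runs_strategy :: "com \<Rightarrow> lfr \<Rightarrow> strategy \<Rightarrow> nat \<Rightarrow> bool" where
  "runs_strategy P I S T \<longleftrightarrow> (\<forall>x. \<exists>t s.
     exec x P (input_state I) t (tests S x) s \<and>
     output_of I s = map int (answer S x) \<and> t \<le> T)"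

end

theory Submission
  imports Defs
begin

text \<open>For a set \<open>S\<close> of tested variables, let \<open>M j k\<close> be the largest possible value of \<open>f\<^sub>j - f\<^sub>k\<close>.
  A ranking is known iff the residual \<open>\<Sum>j k. max 0 (M j k) * max 0 (M k j)\<close> vanishes. The
  residual is an integer, at most \<open>(m D\<^sub>m\<^sub>a\<^sub>x)\<^sup>2\<close> initially, and for a fixed assignment its decrease is a
  submodular function of \<open>S\<close>. The algorithm repeatedly tests a variable that minimises the price \<open>\<theta>\<close>:
  cost divided by expected decrease of the residual.

  The approximation bound is a dual fitting argument. Prices increase along each run, so by
  summation by parts the expected greedy cost is the expectation of
  \<open>\<Sum>t. (\<theta>\<^sub>t - \<theta>\<^sub>t\<^sub>-\<^sub>1) * residual\<^sub>t\<close>. The tests of any correct strategy cover every \<open>residual\<^sub>t\<close>, and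
  whether that strategy tests \<open>i\<close> is independent of \<open>x\<^sub>i\<close>; hence the sum is at most the expected sum,
  over the variables \<open>i\<close> that it tests, of \<open>\<Sum>t. (\<theta>\<^sub>t - \<theta>\<^sub>t\<^sub>-\<^sub>1) * (expected gain of i at time t)\<close>. For each
  of the two outcomes of \<open>i\<close> the gain is a decreasing sequence of integers whose product with
  \<open>\<theta>\<^sub>t\<close> and the probability of that outcome is at most \<open>c\<^sub>i\<close>, which bounds the sum by
  \<open>c\<^sub>i * (1 + ln (initial residual))\<close>.\<close>

section \<open>Greedy for stochastic submodular cover\<close>

text \<open>The coordinates are independent, so \<open>x i\<close> can be redrawn after all the
  others without changing the distribution of \<open>x\<close>.\<close>

lemma expectation_resample:
  fixes p :: "nat \<Rightarrow> real" and F :: "(nat \<Rightarrow> bool) \<Rightarrow> real"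
  assumes "i < n" "0 \<le> p i" "p i \<le> 1"
  defines "M \<equiv> Pi_pmf {..<n} False (\<lambda>i. bernoulli_pmf (p i))"
  shows "measure_pmf.expectation M F =
    measure_pmf.expectation M (\<lambda>x. p i * F (x(i := True)) + (1 - p i) * F (x(i := False)))"
proof -
  define A where "A = {..<n} - {i}"
  define N where "N = Pi_pmf A False (\<lambda>i. bernoulli_pmf (p i))"
  have ins: "{..<n} = insert i A" "i \<notin> A" "finite A"
    using assms(1) by (auto simp: A_def)
  have M: "M = bernoulli_pmf (p i) \<bind> (\<lambda>b. map_pmf (\<lambda>f. f(i := b)) N)"
    unfolding M_def N_def ins(1) using ins(2,3)
    by (simp add: Pi_pmf_insert' map_pmf_def)
  have fin: "finite (set_pmf N)"
    unfolding N_def using ins(3) by (intro finite_subset[OF set_Pi_pmf_subset'] finite_PiE_dflt) auto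
  have split: "measure_pmf.expectation M G =
      p i * measure_pmf.expectation N (\<lambda>f. G (f(i := True)))
    + (1 - p i) * measure_pmf.expectation N (\<lambda>f. G (f(i := False)))"
    for G :: "(nat \<Rightarrow> bool) \<Rightarrow> real"
    unfolding M using assms(2,3) fin
    by (subst pmf_expectation_bind[where A = UNIV]) (auto simp: UNIV_bool)
  have int: "integrable (measure_pmf N) G" for G :: "(nat \<Rightarrow> bool) \<Rightarrow> real"
    using fin by (rule integrable_measure_pmf_finite)
  show ?thesis
    unfolding split[of F] split[of "\<lambda>x. p i * F (x(i := True)) + (1 - p i) * F (x(i := False))"]
    by (simp add: int algebra_simps)
qed

text \<open>Along a greedy run, \<open>\<theta>\<close> is the price per unit of progress and \<open>g\<close> the progress
  offered by a fixed item under a fixed outcome of probability \<open>q\<close>.\<close>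

lemma sum_price_increments_le:
  fixes \<theta> :: "nat \<Rightarrow> real" and g :: "nat \<Rightarrow> int" and q c Q :: real
  assumes g: "\<And>t. t < r \<Longrightarrow> 0 \<le> g t" "\<And>t. t < r \<Longrightarrow> real_of_int (g t) \<le> Q"
    and anti: "\<And>t. Suc t < r \<Longrightarrow> g (Suc t) \<le> g t"
    and price: "\<And>t. t < r \<Longrightarrow> \<theta> t * (q * g t) \<le> c"
    and "0 < q" "0 \<le> c" "1 \<le> Q"
  shows "(\<Sum>t<r. (\<theta> t - (if t = 0 then 0 else \<theta> (t - 1))) * (q * g t)) \<le> c * (1 + ln Q)"
proof -
  \<comment> \<open>Summation by parts up to a time \<open>s\<close> with positive gain. Each term
    \<open>\<theta> t * q * (g t - g (t + 1))\<close> is at most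
    \<open>c * (1 - g (t + 1) / g t)\<close>, hence at most \<open>c * ln (g t / g (t + 1))\<close>,
    and the logarithms telescope.\<close>
  have pos: "(\<Sum>t\<le>s. (\<theta> t - (if t = 0 then 0 else \<theta> (t - 1))) * (q * g t))
      \<le> c * ln (real_of_int (g 0) / g s) + \<theta> s * (q * g s)"
    if "s < r" "0 < g s" for s
    using that
  proof (induction s)
    case (Suc s)
    have gs: "0 < g s" "g (Suc s) \<le> g s" "s < r"
      using anti[of s] Suc.prems by auto
    have g0: "0 < g 0"
    proof -
      have "g s \<le> g 0" if "s < r" for s
        using that by (induction s) (use anti order_trans Suc_lessD in blast)+
      then show ?thesis using gs by force
    qed
    let ?a = "real_of_int (g s)" and ?b = "real_of_int (g (Suc s))"
    have ab: "0 < ?a" "0 < ?b" "?b \<le> ?a" using gs Suc.prems by auto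
    have "\<theta> s * (q * ?a) * (1 - ?b / ?a) \<le> c * (1 - ?b / ?a)"
      using price[OF gs(3)] ab by (intro mult_right_mono) auto
    also have "\<dots> \<le> c * ln (?a / ?b)"
    proof -
      have "ln (?b / ?a) \<le> ?b / ?a - 1" using ab by (intro ln_le_minus_one) auto
      then have "1 - ?b / ?a \<le> ln (?a / ?b)" using ab by (simp add: ln_div)
      then show ?thesis using \<open>0 \<le> c\<close> by (intro mult_left_mono)
    qed
    also have "\<theta> s * (q * ?a) * (1 - ?b / ?a) = \<theta> s * (q * ?a) - \<theta> s * (q * ?b)"
      using ab by (simp add: right_diff_distrib)
    finally have step: "\<theta> s * (q * ?a) - \<theta> s * (q * ?b) \<le> c * ln (?a / ?b)" .
    have "(\<Sum>t\<le>Suc s. (\<theta> t - (if t = 0 then 0 else \<theta> (t - 1))) * (q * g t))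
        \<le> c * ln (g 0 / ?a) + \<theta> s * (q * ?a) + (\<theta> (Suc s) - \<theta> s) * (q * ?b)"
      using Suc.IH gs by simp
    also have "\<dots> \<le> c * ln (g 0 / ?a) + c * ln (?a / ?b) + \<theta> (Suc s) * (q * ?b)"
      using step by (simp add: algebra_simps)
    also have "\<dots> = c * ln (g 0 / ?b) + \<theta> (Suc s) * (q * ?b)"
      using ab g0 by (simp add: ln_div algebra_simps)
    finally show ?case .
  qed simp
  \<comment> \<open>Times with zero gain contribute nothing, so the last positive one decides. There
    the gain is an integer, hence at least 1, which bounds the ratio of gains by \<open>Q\<close>;
    the leftover \<open>\<theta> s * (q * g s)\<close> is at most \<open>c\<close> and supplies the
    summand 1.\<close>
  have "s \<le> r \<Longrightarrow> (\<Sum>t<s. (\<theta> t - (if t = 0 then 0 else \<theta> (t - 1))) * (q * g t)) \<le> c * (1 + ln Q)" for s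
  proof (induction s)
    case 0
    then show ?case using assms(6,7) by simp
  next
    case (Suc s)
    then have s: "s < r" by simp
    show ?case
    proof (cases "g s = 0")
      case True
      then show ?thesis using Suc by simp
    next
      case False
      then have gs: "0 < g s" using g(1)[OF s] by simp
      have "g s \<le> g 0" if "s < r" for s
        using that by (induction s) (use anti order_trans Suc_lessD in blast)+
      then have g0: "1 \<le> g 0" using gs s by force
      have "real_of_int (g 0) / g s \<le> real_of_int (g 0) / 1"
        using gs g0 by (intro divide_left_mono) auto
      then have "real_of_int (g 0) / g s \<le> Q"
        using g(2)[of 0] s by simp
      then have "ln (real_of_int (g 0) / g s) \<le> ln Q"
        using gs g0 assms(7) by (subst ln_le_cancel_iff) auto
      then have "c * ln (real_of_int (g 0) / g s) + \<theta> s * (q * g s) \<le> c * ln Q + c"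
        using price[OF s] \<open>0 \<le> c\<close> by (intro add_mono mult_left_mono)
      then show ?thesis using pos[OF s gs]
        unfolding lessThan_Suc_atMost by (simp add: algebra_simps)
    qed
  qed
  then show ?thesis by simp
qed


text \<open>\<open>R S x\<close> is what remains to be covered once \<open>S\<close> has been
  tested. Submodularity is required for each fixed \<open>x\<close>; \<open>R_cong\<close> lets a
  decision rule evaluate \<open>R\<close> from the outcomes seen so far.\<close>

locale stochastic_submodular_cover =
  fixes n :: nat and p c :: "nat \<Rightarrow> real" and R :: "nat set \<Rightarrow> (nat \<Rightarrow> bool) \<Rightarrow> int"
  assumes prob: "i < n \<Longrightarrow> 0 < p i" "i < n \<Longrightarrow> p i < 1"
    and cost: "i < n \<Longrightarrow> 0 \<le> c i"
    and R_cong: "(\<And>i. i \<in> S \<Longrightarrow> x i = y i) \<Longrightarrow> R S x = R S y"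
    and R_nonneg: "0 \<le> R S x"
    and R_insert_le: "R (insert i S) x \<le> R S x"
    and R_submodular: "S \<subseteq> S' \<Longrightarrow> R S' x - R (insert i S') x \<le> R S x - R (insert i S) x"
    and R_full: "{..<n} \<subseteq> S \<Longrightarrow> R S x = 0"
begin

section \<open>Expected gains, prices and the greedy choice\<close>

definition gain :: "nat \<Rightarrow> nat set \<Rightarrow> (nat \<Rightarrow> bool) \<Rightarrow> int" where
  "gain i S x = R S x - R (insert i S) x"

text \<open>This is the form that the program evaluates: the current remainder minus the remainder
  after a hypothetical outcome. For \<open>i\<close> outside \<open>S\<close> it is the gain of
  \<open>i\<close> at \<open>x(i := b)\<close>.\<close>

definition outcome_gain :: "nat \<Rightarrow> bool \<Rightarrow> nat set \<Rightarrow> (nat \<Rightarrow> bool) \<Rightarrow> int" where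
  "outcome_gain i b S x = R S x - R (insert i S) (x(i := b))"

definition exp_gain :: "nat \<Rightarrow> nat set \<Rightarrow> (nat \<Rightarrow> bool) \<Rightarrow> real" where
  "exp_gain i S x = p i * outcome_gain i True S x + (1 - p i) * outcome_gain i False S x"

definition price :: "nat \<Rightarrow> nat set \<Rightarrow> (nat \<Rightarrow> bool) \<Rightarrow> real" where
  "price i S x = c i / exp_gain i S x"

text \<open>An explicit scan with ties going to the smaller index, so that a loop can reproduce it
  exactly. Only variables of positive expected gain take part, for which \<open>price\<close> is a
  genuine quotient.\<close>

fun best_below :: "nat \<Rightarrow> nat set \<Rightarrow> (nat \<Rightarrow> bool) \<Rightarrow> nat option" where
  "best_below 0 S x = None"
| "best_below (Suc k) S x =
    (if k \<notin> S \<and> 0 < exp_gain k S x \<and>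
        (case best_below k S x of None \<Rightarrow> True | Some b \<Rightarrow> price k S x < price b S x)
     then Some k else best_below k S x)"

definition best :: "nat set \<Rightarrow> (nat \<Rightarrow> bool) \<Rightarrow> nat" where
  "best S x = the (best_below n S x)"

lemma outcome_gain_eq: "i \<notin> S \<Longrightarrow> outcome_gain i b S x = gain i S (x(i := b))"
  unfolding outcome_gain_def gain_def by (simp, rule R_cong) auto

lemma gain_nonneg: "0 \<le> gain i S x"
  unfolding gain_def using R_insert_le by simp

lemma outcome_gain_nonneg: "i \<notin> S \<Longrightarrow> 0 \<le> outcome_gain i b S x"
  by (simp add: outcome_gain_eq gain_nonneg)

lemma outcome_gain_le_R: "outcome_gain i b S x \<le> R S x"
  unfolding outcome_gain_def using R_nonneg by simp

lemma outcome_gain_antimono: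
  "S \<subseteq> S' \<Longrightarrow> i \<notin> S' \<Longrightarrow> outcome_gain i b S' x \<le> outcome_gain i b S x"
  using R_submodular[of S S' "x(i := b)" i] outcome_gain_eq[of i S] outcome_gain_eq[of i S']
  unfolding gain_def by (metis subsetD)

lemma outcome_gain_cong:
  assumes "\<And>k. k \<in> S \<Longrightarrow> x k = y k"
  shows "outcome_gain i b S x = outcome_gain i b S y"
  unfolding outcome_gain_def
  using assms by (intro arg_cong2[where f = "(-)"] R_cong) auto

lemma exp_gain_cong:
  assumes "\<And>k. k \<in> S \<Longrightarrow> x k = y k"
  shows "exp_gain i S x = exp_gain i S y"
  unfolding exp_gain_def using outcome_gain_cong[of S x y] assms by simp

lemma exp_gain_ge:
  assumes "i < n" "i \<notin> S"
  shows "p i * outcome_gain i True S x \<le> exp_gain i S x"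
    and "(1 - p i) * outcome_gain i False S x \<le> exp_gain i S x"
  using prob[OF assms(1)] outcome_gain_nonneg[OF assms(2), of True x]
    outcome_gain_nonneg[OF assms(2), of False x]
  unfolding exp_gain_def by auto

lemma exp_gain_nonneg: "i < n \<Longrightarrow> i \<notin> S \<Longrightarrow> 0 \<le> exp_gain i S x"
  using prob[of i] outcome_gain_nonneg[of i S True x] outcome_gain_nonneg[of i S False x]
  unfolding exp_gain_def by simp

lemma exp_gain_antimono:
  assumes "S \<subseteq> S'" "i \<notin> S'" "i < n"
  shows "exp_gain i S' x \<le> exp_gain i S x"
  unfolding exp_gain_def
  using prob[OF assms(3)] outcome_gain_antimono[OF assms(1,2)]
  by (intro add_mono mult_left_mono) auto

lemma price_cong:
  assumes "\<And>k. k \<in> S \<Longrightarrow> x k = y k"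
  shows "price i S x = price i S y"
  unfolding price_def using exp_gain_cong[of S x y i] assms by simp

lemma best_below_cong:
  assumes "\<And>k. k \<in> S \<Longrightarrow> x k = y k"
  shows "best_below k S x = best_below k S y"
proof -
  have "exp_gain i S x = exp_gain i S y" "price i S x = price i S y" for i
    using exp_gain_cong[of S x y i] price_cong[of S x y i] assms by auto
  then show ?thesis by (induction k) (auto split: option.splits)
qed

lemma best_cong: "(\<And>k. k \<in> S \<Longrightarrow> x k = y k) \<Longrightarrow> best S x = best S y"
  unfolding best_def using best_below_cong[of S x y] by simp

text \<open>If the elements of \<open>T\<close> are added one at a time, submodularity bounds each
  drop by the gain at \<open>S\<close> itself. This is how the tests of a competitor are compared
  with the current state of greedy.\<close>

lemma R_le_sum_gain:
  assumes "finite T"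
  shows "R S x \<le> R (S \<union> T) x + (\<Sum>i\<in>T. gain i S x)"
  using assms
proof (induction T)
  case (insert i T)
  have "R (S \<union> T) x - R (insert i (S \<union> T)) x \<le> gain i S x"
    unfolding gain_def by (rule R_submodular) auto
  then show ?case using insert by simp
qed simp

lemma R_mono:
  assumes "finite T"
  shows "R (S \<union> T) x \<le> R S x"
  using assms
proof (induction T)
  case (insert i T)
  then show ?case using R_insert_le[of i "S \<union> T" x] by simp
qed simp

lemma gain_mem: "i \<in> S \<Longrightarrow> gain i S x = 0"
  unfolding gain_def by (simp add: insert_absorb)

lemma best_below_None:
  "best_below k S x = None \<Longrightarrow> i < k \<Longrightarrow> i \<notin> S \<Longrightarrow> exp_gain i S x \<le> 0"
  by (induction k) (auto split: if_splits simp: less_Suc_eq)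

lemma best_below_Some:
  "best_below k S x = Some b \<Longrightarrow>
    b < k \<and> b \<notin> S \<and> 0 < exp_gain b S x \<and>
    (\<forall>i<k. i \<notin> S \<longrightarrow> 0 < exp_gain i S x \<longrightarrow> price b S x \<le> price i S x)"
proof (induction k arbitrary: b)
  case (Suc k)
  show ?case
  proof (cases "best_below k S x")
    case None
    then show ?thesis
      using Suc.prems best_below_None[OF None] by (force split: if_splits simp: less_Suc_eq)
  next
    case (Some b')
    then show ?thesis
      using Suc.prems Suc.IH[OF Some] by (fastforce split: if_splits simp: less_Suc_eq)
  qed
qed simp

text \<open>Otherwise both outcomes of every untested variable would have gain 0, since both have
  positive probability. Then testing all variables would leave \<open>R\<close> unchanged, although
  the full set has remainder 0. So greedy never gets stuck.\<close>

lemma exp_gain_pos_exists: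
  assumes "0 < R S x"
  shows "\<exists>i<n. i \<notin> S \<and> 0 < exp_gain i S x"
proof (rule ccontr)
  assume neg: "\<not> ?thesis"
  have "gain i S x = 0" if "i < n" for i
  proof (cases "i \<in> S")
    case False
    then have "exp_gain i S x = 0"
      using neg exp_gain_nonneg[OF that False, of x] that by force
    then have "p i * outcome_gain i True S x = 0" "(1 - p i) * outcome_gain i False S x = 0"
      using exp_gain_ge[OF that False, of x] outcome_gain_nonneg[OF False, of True x]
        outcome_gain_nonneg[OF False, of False x] prob[OF that]
      unfolding exp_gain_def by (smt (verit) mult_nonneg_nonneg of_int_0_le_iff)+
    then have "outcome_gain i b S x = 0" for b
      using prob[OF that] by (cases b) auto
    then show ?thesis
      using outcome_gain_eq[OF False, of "x i" x] by simp
  qed (rule gain_mem)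
  then have "R S x \<le> R (S \<union> {..<n}) x"
    using R_le_sum_gain[of "{..<n}" S x] by simp
  then show False using assms R_full[of "S \<union> {..<n}" x] by simp
qed

text \<open>The price comparison is stated as a product so that it also covers variables of expected
  gain 0.\<close>

lemma best:
  assumes "0 < R S x"
  shows "best S x < n" "best S x \<notin> S" "0 < exp_gain (best S x) S x"
    and "i < n \<Longrightarrow> i \<notin> S \<Longrightarrow> price (best S x) S x * exp_gain i S x \<le> c i"
proof -
  obtain b where b: "best_below n S x = Some b"
    using exp_gain_pos_exists[OF assms] best_below_None[of n S x] by fastforce
  then have bb: "best S x = b" by (simp add: best_def)
  note * = best_below_Some[OF b]
  show "best S x < n" "best S x \<notin> S" "0 < exp_gain (best S x) S x"
    using * bb by auto
  assume i: "i < n" "i \<notin> S"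
  show "price (best S x) S x * exp_gain i S x \<le> c i"
  proof (cases "0 < exp_gain i S x")
    case True
    then have "price b S x \<le> price i S x" using * i by blast
    then show ?thesis using True bb by (simp add: price_def[of i] pos_le_divide_eq)
  next
    case False
    then have "exp_gain i S x = 0" using exp_gain_nonneg[OF i, of x] by simp
    then show ?thesis using cost[OF i(1)] by simp
  qed
qed

lemma price_best_nonneg: "0 < R S x \<Longrightarrow> 0 \<le> price (best S x) S x"
  unfolding price_def using best[of S x] cost[of "best S x"] by simp

section \<open>Greedy runs and the growth of their prices\<close>

primrec run :: "nat \<Rightarrow> (nat \<Rightarrow> bool) \<Rightarrow> nat set" where
  "run 0 x = {}"
| "run (Suc t) x = (if R (run t x) x = 0 then run t x else insert (best (run t x) x) (run t x))"

definition active :: "nat \<Rightarrow> (nat \<Rightarrow> bool) \<Rightarrow> bool" where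
  "active t x \<longleftrightarrow> 0 < R (run t x) x"

definition \<theta> :: "nat \<Rightarrow> (nat \<Rightarrow> bool) \<Rightarrow> real" where
  "\<theta> t x = price (best (run t x) x) (run t x) x"

definition incr :: "nat \<Rightarrow> (nat \<Rightarrow> bool) \<Rightarrow> real" where
  "incr t x = \<theta> t x - (if t = 0 then 0 else \<theta> (t - 1) x)"

lemma not_active: "\<not> active t x \<Longrightarrow> R (run t x) x = 0"
  using R_nonneg[of "run t x" x] by (simp add: active_def)

lemma run_active: "active t x \<Longrightarrow> run (Suc t) x = insert (best (run t x) x) (run t x)"
  by (simp add: active_def)

lemma active_SucD: "active (Suc t) x \<Longrightarrow> active t x"
  using R_nonneg[of "run t x" x] by (auto simp: active_def split: if_splits)

lemma active_antimono: "active t x \<Longrightarrow> s \<le> t \<Longrightarrow> active s x"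
  by (induction t) (auto simp: le_Suc_eq dest: active_SucD)

lemma run_mono: "s \<le> t \<Longrightarrow> run s x \<subseteq> run t x"
  by (induction t rule: dec_induct) auto

lemma run_subset: "run t x \<subseteq> {..<n}"
proof (induction t)
  case (Suc t)
  then show ?case using best(1)[of "run t x" x] R_nonneg[of "run t x" x]
    by (cases "R (run t x) x = 0") auto
qed simp

lemma card_run: "active t x \<Longrightarrow> card (run (Suc t) x) = Suc t"
proof (induction t)
  case 0
  then show ?case by (simp add: active_def)
next
  case (Suc t)
  have "finite (run (Suc t) x)" using run_subset[of "Suc t" x] finite_subset by blast
  moreover have "best (run (Suc t) x) x \<notin> run (Suc t) x"
    using best(2) Suc.prems unfolding active_def by blast
  ultimately show ?case
    using Suc active_SucD by (simp add: run_active del: run.simps)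
qed

text \<open>Every active step adds a new variable below \<open>n\<close>. Hence sums along runs of
  different lengths can all range over \<open>t < n\<close>.\<close>

lemma not_active_n: "\<not> active n x"
proof
  assume act: "active n x"
  have "card (run (Suc n) x) \<le> card {..<n}"
    by (intro card_mono run_subset) simp
  then show False using card_run[OF act] by simp
qed

text \<open>Until \<open>i\<close> is tested, the run has read only other variables. So whether
  \<open>i\<close> has been tested by time \<open>t\<close>, and everything determined while it has
  not, is independent of \<open>x i\<close>.\<close>

lemma run_flip: "i \<notin> run t x \<Longrightarrow> run t (x(i := b)) = run t x"
proof (induction t)
  case (Suc t)
  have i: "i \<notin> run t x" using Suc.prems run_mono[of t "Suc t" x] by auto
  note IH = Suc.IH[OF i]
  have "R (run t x) (x(i := b)) = R (run t x) x" "best (run t x) (x(i := b)) = best (run t x) x"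
    using i by (intro R_cong best_cong; auto)+
  then show ?case using IH by (simp only: run.simps)
qed simp

lemma run_flip_mem: "i \<in> run t (x(i := b)) \<longleftrightarrow> i \<in> run t x"
  using run_flip[of i t x b] run_flip[of i t "x(i := b)" "x i"] by auto

lemma active_flip: "i \<notin> run t x \<Longrightarrow> active t (x(i := b)) = active t x"
  unfolding active_def using run_flip[of i t x b] by (simp, subst R_cong[of _ _ x]) auto

lemma best_flip: "i \<notin> run t x \<Longrightarrow> best (run t x) (x(i := b)) = best (run t x) x"
  by (intro best_cong) auto

lemma \<theta>_flip: "i \<notin> run t x \<Longrightarrow> \<theta> t (x(i := b)) = \<theta> t x"
  unfolding \<theta>_def using run_flip[of i t x b] best_flip[of i t x b]
  by (simp, intro price_cong) auto

lemma incr_flip: "i \<notin> run t x \<Longrightarrow> incr t (x(i := b)) = incr t x"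
  unfolding incr_def using run_mono[of "t - 1" t x] \<theta>_flip[of i t x b] \<theta>_flip[of i "t - 1" x b] by auto

text \<open>The variable chosen at time \<open>s + 1\<close> was already available at time
  \<open>s\<close>, with an expected gain at least as large and hence a price at most as high; the
  choice at time \<open>s\<close> did no worse. So prices never fall, and their increments can serve
  as dual weights.\<close>

lemma incr_nonneg:
  assumes "active t x"
  shows "0 \<le> incr t x"
proof (cases t)
  case 0
  then show ?thesis
    using assms price_best_nonneg unfolding incr_def \<theta>_def active_def by simp
next
  case (Suc s)
  let ?S = "run s x" and ?S' = "run (Suc s) x"
  let ?b = "best ?S' x"
  have act: "active s x" "active (Suc s) x" using assms Suc active_SucD by auto
  have b: "?b < n" "?b \<notin> ?S'" "0 < exp_gain ?b ?S' x"
    using best act(2) unfolding active_def by blast+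
  have sub: "?S \<subseteq> ?S'" by (rule run_mono) simp
  have "\<theta> s x * exp_gain ?b ?S' x \<le> \<theta> s x * exp_gain ?b ?S x"
    using exp_gain_antimono[OF sub b(2,1)] price_best_nonneg act(1)
    unfolding active_def \<theta>_def by (intro mult_left_mono) auto
  also have "\<dots> \<le> c ?b"
    using best(4)[of ?S x ?b] b sub act(1) unfolding active_def \<theta>_def by auto
  finally have "\<theta> s x \<le> \<theta> (Suc s) x"
    unfolding \<theta>_def[of "Suc s"] price_def using b(3) by (simp add: pos_le_divide_eq)
  then show ?thesis unfolding incr_def Suc by simp
qed

section \<open>Expected greedy cost by dual fitting\<close>

abbreviation Ex :: "((nat \<Rightarrow> bool) \<Rightarrow> real) \<Rightarrow> real" where
  "Ex \<equiv> measure_pmf.expectation (Pi_pmf {..<n} False (\<lambda>i. bernoulli_pmf (p i)))"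

lemma integrable_Ex:
  "integrable (measure_pmf (Pi_pmf {..<n} False (\<lambda>i. bernoulli_pmf (p i)))) (F :: _ \<Rightarrow> real)"
  by (intro integrable_measure_pmf_finite finite_subset[OF set_Pi_pmf_subset'] finite_PiE_dflt) auto

lemma Ex_mono: "(\<And>x. F x \<le> G x) \<Longrightarrow> Ex F \<le> Ex G"
  by (intro integral_mono integrable_Ex)

lemma Ex_sum: "Ex (\<lambda>x. \<Sum>k\<in>A. F k x) = (\<Sum>k\<in>A. Ex (F k))"
  by (intro Bochner_Integration.integral_sum integrable_Ex)

text \<open>The weight is independent of \<open>x i\<close> and vanishes once \<open>i\<close> has
  been tested, so averaging over \<open>x i\<close> first turns the actual gain into the expected
  one. It is applied to weights given by greedy's choice and to weights given by a competitor's
  tests.\<close>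

lemma Ex_gain:
  fixes w :: "(nat \<Rightarrow> bool) \<Rightarrow> real"
  assumes "i < n" "\<And>x b. w (x(i := b)) = w x" "\<And>x. i \<in> run t x \<Longrightarrow> w x = 0"
  shows "Ex (\<lambda>x. w x * gain i (run t x) x) = Ex (\<lambda>x. w x * exp_gain i (run t x) x)"
proof -
  have "p i * (w (x(i := True)) * gain i (run t (x(i := True))) (x(i := True)))
      + (1 - p i) * (w (x(i := False)) * gain i (run t (x(i := False))) (x(i := False)))
      = w x * exp_gain i (run t x) x" for x
  proof (cases "i \<in> run t x")
    case False
    then show ?thesis
      by (simp add: assms(2) run_flip exp_gain_def outcome_gain_eq algebra_simps)
  qed (simp add: assms(2,3))
  then show ?thesis
    using prob[OF assms(1)]
    by (subst expectation_resample[OF assms(1)]) auto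
qed

definition greedy_cost :: "(nat \<Rightarrow> bool) \<Rightarrow> real" where
  "greedy_cost x = (\<Sum>t<n. if active t x then c (best (run t x) x) else 0)"

text \<open>The cost of the chosen variable is its price times its expected gain, and in expectation
  the latter can be exchanged for the actual drop of \<open>R\<close>.\<close>

lemma Ex_step_cost:
  "Ex (\<lambda>x. if active t x then c (best (run t x) x) else 0) =
   Ex (\<lambda>x. \<theta> t x * (R (run t x) x - R (run (Suc t) x) x))"
proof -
  \<comment> \<open>Splitting by the chosen variable yields weights independent of
    \<open>x i\<close>, because the choice of \<open>i\<close> precedes its test.\<close>
  define w where "w i x = (if active t x \<and> best (run t x) x = i then \<theta> t x else 0)" for i x
  have mem: "w i x = 0" if "i \<in> run t x" for i x
    using that best(2) unfolding w_def active_def by auto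
  have flip: "w i (x(i := b)) = w i x" for i x b
  proof (cases "i \<in> run t x")
    case True
    then show ?thesis using mem run_flip_mem by metis
  next
    case False
    then show ?thesis
      unfolding w_def by (simp add: run_flip active_flip \<theta>_flip best_flip)
  qed
  have "(if active t x then c (best (run t x) x) else 0) = (\<Sum>i<n. w i x * exp_gain i (run t x) x)"
    for x
  proof (cases "active t x")
    case True
    let ?b = "best (run t x) x"
    have b: "?b < n" "0 < exp_gain ?b (run t x) x"
      using best(1,3) True unfolding active_def by auto
    have "(\<Sum>i<n. w i x * exp_gain i (run t x) x) = (\<Sum>i<n. if ?b = i then c i else 0)"
      using True b(2) by (intro sum.cong) (auto simp: w_def \<theta>_def price_def)
    then show ?thesis using True b(1) by simp
  qed (simp add: w_def)
  moreover have "\<theta> t x * (R (run t x) x - R (run (Suc t) x) x) = (\<Sum>i<n. w i x * gain i (run t x) x)"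
    for x
  proof (cases "active t x")
    case True
    let ?b = "best (run t x) x"
    have b: "?b < n" using best(1) True unfolding active_def by auto
    have "(\<Sum>i<n. w i x * gain i (run t x) x) = (\<Sum>i<n. if ?b = i then \<theta> t x * gain i (run t x) x else 0)"
      using True by (intro sum.cong) (auto simp: w_def)
    then show ?thesis using b by (simp add: gain_def run_active[OF True] del: run.simps)
  next
    case False
    then show ?thesis using not_active[OF False] by (simp add: w_def)
  qed
  ultimately show ?thesis
    by (simp add: Ex_sum Ex_gain[OF _ flip mem] del: run.simps)
qed

text \<open>Summation by parts; the boundary term vanishes because the remainder is 0 after
  \<open>n\<close> steps.\<close>

lemma sum_step_eq_sum_incr:
  "(\<Sum>t<n. \<theta> t x * (R (run t x) x - R (run (Suc t) x) x)) =
   (\<Sum>t<n. if active t x then incr t x * R (run t x) x else 0)"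
proof -
  have "(\<Sum>t<k. \<theta> t x * (R (run t x) x - R (run (Suc t) x) x)) =
      (\<Sum>t<k. incr t x * R (run t x) x) - (if k = 0 then 0 else \<theta> (k - 1) x) * R (run k x) x" for k
    by (induction k) (simp_all add: incr_def algebra_simps del: run.simps)
  from this[of n] have "(\<Sum>t<n. \<theta> t x * (R (run t x) x - R (run (Suc t) x) x)) =
      (\<Sum>t<n. incr t x * R (run t x) x)"
    using not_active[OF not_active_n, of x] by simp
  also have "\<dots> = (\<Sum>t<n. if active t x then incr t x * R (run t x) x else 0)"
    by (intro sum.cong) (auto simp: not_active)
  finally show ?thesis .
qed

text \<open>Dual feasibility, up to the factor of the bound. Expected gains are not integers, so the
  two outcomes are treated separately, with \<open>q = p i\<close> and \<open>q = 1 - p i\<close>.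
  This costs the factor 2 but keeps the bound free of the probabilities.\<close>

lemma sum_incr_exp_gain_le:
  assumes "i < n" "\<And>x. real_of_int (R {} x) \<le> Q" "1 \<le> Q"
  shows "(\<Sum>t<n. if active t x \<and> i \<notin> run t x then incr t x * exp_gain i (run t x) x else 0)
    \<le> 2 * (1 + ln Q) * c i"
proof -
  define P where "P t \<longleftrightarrow> active t x \<and> i \<notin> run t x" for t
  have down: "P s" if "P t" "s \<le> t" for s t
    using that active_antimono run_mono[of s t x] unfolding P_def by blast
  \<comment> \<open>The times at which \<open>i\<close> is still on offer are closed downwards, so
    they form an initial segment.\<close>
  have "\<exists>r. r \<le> k \<and> (\<forall>t<k. P t \<longleftrightarrow> t < r)" for k
  proof (induction k)
    case (Suc k)
    then obtain r where r: "r \<le> k" "\<forall>t<k. P t \<longleftrightarrow> t < r" by blast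
    show ?case
    proof (cases "P k")
      case True
      then show ?thesis using down by (intro exI[of _ "Suc k"]) auto
    next
      case False
      then show ?thesis using r by (intro exI[of _ r]) (auto simp: less_Suc_eq)
    qed
  qed simp
  then obtain r where r: "r \<le> n" "\<And>t. t < n \<Longrightarrow> P t \<longleftrightarrow> t < r" by blast
  have Pr: "active t x" "i \<notin> run t x" if "t < r" for t
    using r(1) r(2)[of t] that unfolding P_def by auto
  have R_le: "real_of_int (R (run t x) x) \<le> Q" for t
  proof -
    have "finite (run t x)" using run_subset finite_subset by blast
    then have "R ({} \<union> run t x) x \<le> R {} x" by (rule R_mono)
    then show ?thesis using assms(2)[of x] by simp
  qed
  have outcome: "(\<Sum>t<r. incr t x * (q * outcome_gain i b (run t x) x)) \<le> c i * (1 + ln Q)"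
    if q: "0 < q" "\<And>t. t < r \<Longrightarrow> q * outcome_gain i b (run t x) x \<le> exp_gain i (run t x) x" for q :: real and b
    unfolding incr_def
  proof (rule sum_price_increments_le)
    fix t assume t: "t < r"
    show "0 \<le> outcome_gain i b (run t x) x"
      using Pr[OF t] by (intro outcome_gain_nonneg)
    have "real_of_int (outcome_gain i b (run t x) x) \<le> R (run t x) x"
      using outcome_gain_le_R by simp
    then show "real_of_int (outcome_gain i b (run t x) x) \<le> Q"
      using R_le[of t] by simp
    have act: "0 < R (run t x) x" using Pr[OF t] by (simp add: active_def)
    have "\<theta> t x * (q * outcome_gain i b (run t x) x) \<le> \<theta> t x * exp_gain i (run t x) x"
      using price_best_nonneg[OF act] q(2)[OF t] unfolding \<theta>_def by (intro mult_left_mono)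
    then show "\<theta> t x * (q * outcome_gain i b (run t x) x) \<le> c i"
      using best(4)[OF act assms(1) Pr(2)[OF t]] unfolding \<theta>_def by simp
  next
    fix t assume t: "Suc t < r"
    show "outcome_gain i b (run (Suc t) x) x \<le> outcome_gain i b (run t x) x"
      using Pr[OF t] run_mono[of t "Suc t" x] by (intro outcome_gain_antimono) auto
  qed (use q assms cost in auto)
  have "(\<Sum>t<n. if active t x \<and> i \<notin> run t x then incr t x * exp_gain i (run t x) x else 0) =
      (\<Sum>t<n. if t < r then incr t x * exp_gain i (run t x) x else 0)"
    using r unfolding P_def by (intro sum.cong) auto
  also have "\<dots> = (\<Sum>t<r. incr t x * exp_gain i (run t x) x)"
    using r(1) by (intro sum.mono_neutral_cong_right) auto
  also have "\<dots> = (\<Sum>t<r. incr t x * (p i * outcome_gain i True (run t x) x))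
      + (\<Sum>t<r. incr t x * ((1 - p i) * outcome_gain i False (run t x) x))"
    unfolding exp_gain_def by (simp add: sum.distrib distrib_left)
  also have "\<dots> \<le> c i * (1 + ln Q) + c i * (1 + ln Q)"
    using prob[OF assms(1)] exp_gain_ge[OF assms(1)] Pr by (intro add_mono outcome) auto
  finally show ?thesis by (simp add: algebra_simps)
qed

text \<open>A test outcome is independent of whether the competing procedure \<open>T\<close> performs that test;
  this is what \<open>flip\<close> expresses.\<close>

theorem greedy_cost_le:
  assumes T: "\<And>x. T x \<subseteq> {..<n}" "\<And>x. R (T x) x = 0"
    and flip: "\<And>i x b. i \<in> T (x(i := b)) \<longleftrightarrow> i \<in> T x"
    and Q: "\<And>x. real_of_int (R {} x) \<le> Q" "1 \<le> Q"
  shows "Ex greedy_cost \<le> 2 * (1 + ln Q) * Ex (\<lambda>x. \<Sum>i\<in>T x. c i)"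
proof -
  \<comment> \<open>Each test \<open>i\<close> of the competitor is charged the price increment of
    every active time at which greedy has not yet tested \<open>i\<close>. All these conditions are
    independent of \<open>x i\<close>.\<close>
  define w where "w i t x = (if i \<in> T x \<and> active t x \<and> i \<notin> run t x then incr t x else 0)" for i t x
  have w_flip: "w i t (x(i := b)) = w i t x" for i t x b
    unfolding w_def using flip[of i x b] run_flip_mem[of i t x b] active_flip[of i t x b]
      incr_flip[of i t x b] by auto
  have w_mem: "i \<in> run t x \<Longrightarrow> w i t x = 0" for i t x
    by (simp add: w_def)
  \<comment> \<open>Since \<open>T x\<close> leaves remainder 0, the gains that its tests offer at
    time \<open>t\<close> add up to at least the current remainder.\<close>
  have cover: "(if active t x then incr t x * R (run t x) x else 0) \<le> (\<Sum>i<n. w i t x * gain i (run t x) x)"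
    for t x
  proof (cases "active t x")
    case True
    have fin: "finite (T x)" "finite (run t x)"
      using finite_subset[OF T(1)] finite_subset[OF run_subset] by auto
    have "R (run t x \<union> T x) x \<le> 0"
      using R_mono[OF fin(2), of "T x" x] T(2)[of x] by (simp add: Un_commute)
    then have "R (run t x) x \<le> (\<Sum>i\<in>T x. gain i (run t x) x)"
      using R_le_sum_gain[OF fin(1), of "run t x" x] by simp
    then have "incr t x * R (run t x) x \<le> incr t x * (\<Sum>i\<in>T x. gain i (run t x) x)"
      using incr_nonneg[OF True] by (intro mult_left_mono) linarith+
    also have "\<dots> = (\<Sum>i\<in>T x. w i t x * gain i (run t x) x)"
      unfolding of_int_sum sum_distrib_left
      using True by (intro sum.cong) (auto simp: w_def gain_mem)
    also have "\<dots> = (\<Sum>i<n. w i t x * gain i (run t x) x)"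
      using T(1)[of x] by (intro sum.mono_neutral_left) (auto simp: w_def)
    finally show ?thesis using True by simp
  qed (simp add: w_def)
  have "Ex greedy_cost = Ex (\<lambda>x. \<Sum>t<n. if active t x then incr t x * R (run t x) x else 0)"
    unfolding greedy_cost_def sum_step_eq_sum_incr[symmetric] Ex_sum Ex_step_cost ..
  also have "\<dots> \<le> Ex (\<lambda>x. \<Sum>t<n. \<Sum>i<n. w i t x * gain i (run t x) x)"
    by (intro Ex_mono sum_mono cover)
  also have "\<dots> = (\<Sum>t<n. \<Sum>i<n. Ex (\<lambda>x. w i t x * exp_gain i (run t x) x))"
    by (simp add: Ex_sum Ex_gain[OF _ w_flip w_mem])
  also have "\<dots> = Ex (\<lambda>x. \<Sum>i<n. \<Sum>t<n. w i t x * exp_gain i (run t x) x)"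
    by (subst sum.swap) (simp add: Ex_sum)
  also have "\<dots> \<le> Ex (\<lambda>x. \<Sum>i<n. if i \<in> T x then 2 * (1 + ln Q) * c i else 0)"
  proof (intro Ex_mono sum_mono)
    fix x i assume i: "i \<in> {..<n}"
    have "(\<Sum>t<n. w i t x * exp_gain i (run t x) x) =
        (if i \<in> T x then \<Sum>t<n. if active t x \<and> i \<notin> run t x then incr t x * exp_gain i (run t x) x else 0 else 0)"
      by (auto simp: w_def intro!: sum.cong)
    then show "(\<Sum>t<n. w i t x * exp_gain i (run t x) x) \<le> (if i \<in> T x then 2 * (1 + ln Q) * c i else 0)"
      using sum_incr_exp_gain_le[of i Q x] i Q by auto
  qed
  also have "\<dots> = Ex (\<lambda>x. 2 * (1 + ln Q) * (\<Sum>i\<in>T x. c i))"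
  proof -
    have "(\<Sum>i<n. if i \<in> T x then 2 * (1 + ln Q) * c i else 0) = 2 * (1 + ln Q) * (\<Sum>i\<in>T x. c i)" for x
      using T(1)[of x] unfolding sum_distrib_left by (subst sum.mono_neutral_cong_right[of _ "T x"]) auto
    then show ?thesis by simp
  qed
  finally show ?thesis by simp
qed

end

section \<open>The residual of a ranking problem\<close>

text \<open>\<open>max_diff I S x j k\<close> is the maximum of \<open>lin_fun I j x' - lin_fun I k x'\<close> over all \<open>x'\<close> that
  agree with \<open>x\<close> on \<open>S\<close>.\<close>

definition max_diff :: "lfr \<Rightarrow> nat set \<Rightarrow> (nat \<Rightarrow> bool) \<Rightarrow> nat \<Rightarrow> nat \<Rightarrow> int" where
  "max_diff I S x j k = (\<Sum>i<num_vars I.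
     if i \<in> S then (coeff I j i - coeff I k i) * of_bool (x i) else max 0 (coeff I j i - coeff I k i))"

text \<open>A summand is positive exactly while both strict orders of the two functions are
  possible. The factors are multiplied because excluding one of the two orders already settles the
  comparison.\<close>

definition residual :: "lfr \<Rightarrow> nat set \<Rightarrow> (nat \<Rightarrow> bool) \<Rightarrow> int" where
  "residual I S x = (\<Sum>j<num_funs I. \<Sum>k<num_funs I.
     max 0 (max_diff I S x j k) * max 0 (max_diff I S x k j))"

lemma max_diff_upper:
  assumes "\<And>i. i \<in> S \<Longrightarrow> x' i = x i"
  shows "lin_fun I j x' - lin_fun I k x' \<le> max_diff I S x j k"
proof -
  have "lin_fun I j x' - lin_fun I k x' = (\<Sum>i<num_vars I. (coeff I j i - coeff I k i) * of_bool (x' i))"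
    unfolding lin_fun_def by (simp add: sum_subtractf left_diff_distrib)
  also have "\<dots> \<le> max_diff I S x j k"
    unfolding max_diff_def using assms by (intro sum_mono) auto
  finally show ?thesis .
qed

lemma max_diff_attained:
  "\<exists>x'. (\<forall>i\<in>S. x' i = x i) \<and> lin_fun I j x' - lin_fun I k x' = max_diff I S x j k"
proof -
  define x' where "x' i = (if i \<in> S then x i else 0 < coeff I j i - coeff I k i)" for i
  have "lin_fun I j x' - lin_fun I k x' = (\<Sum>i<num_vars I. (coeff I j i - coeff I k i) * of_bool (x' i))"
    unfolding lin_fun_def by (simp add: sum_subtractf left_diff_distrib)
  also have "\<dots> = max_diff I S x j k"
    unfolding max_diff_def by (intro sum.cong) (auto simp: x'_def)
  finally show ?thesis by (intro exI[of _ x']) (simp add: x'_def)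
qed

lemma max_diff_cong:
  "(\<And>i. i \<in> S \<Longrightarrow> x i = y i) \<Longrightarrow> max_diff I S x j k = max_diff I S y j k"
  unfolding max_diff_def by (intro sum.cong) auto

lemma residual_cong:
  assumes "\<And>i. i \<in> S \<Longrightarrow> x i = y i"
  shows "residual I S x = residual I S y"
  unfolding residual_def using max_diff_cong[of S x y] assms by simp

lemma residual_nonneg: "0 \<le> residual I S x"
  unfolding residual_def by (intro sum_nonneg) auto

lemma max_diff_self: "max_diff I S x j j = 0"
  unfolding max_diff_def by (intro sum.neutral) auto

lemma residual_eq_0_iff:
  "residual I S x = 0 \<longleftrightarrow>
    (\<forall>j<num_funs I. \<forall>k<num_funs I. max_diff I S x j k \<le> 0 \<or> max_diff I S x k j \<le> 0)"
  unfolding residual_def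
  by (subst sum_nonneg_eq_0_iff; (simp add: sum_nonneg)?)
    (auto simp: sum_nonneg_eq_0_iff max_def split: if_splits; force)

text \<open>The loss caused by testing \<open>i\<close> outside \<open>S\<close> depends on
  \<open>x i\<close> but not on \<open>S\<close>. This reduces submodularity of the residual to
  arithmetic on a single pair of functions.\<close>

lemma max_diff_insert:
  "max_diff I (insert i S) x j k = max_diff I S x j k -
    (if i < num_vars I \<and> i \<notin> S
     then max 0 (coeff I j i - coeff I k i) - (coeff I j i - coeff I k i) * of_bool (x i) else 0)"
proof (cases "i < num_vars I \<and> i \<notin> S")
  case True
  let ?b = "\<lambda>i. coeff I j i - coeff I k i"
  let ?f = "\<lambda>S i. if i \<in> S then ?b i * of_bool (x i) else max 0 (?b i)"
  have "(\<Sum>l<num_vars I. ?f (insert i S) l) - (\<Sum>l<num_vars I. ?f S l)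
      = (\<Sum>l<num_vars I. if l = i then ?b i * of_bool (x i) - max 0 (?b i) else 0)"
    unfolding sum_subtractf[symmetric] using True by (intro sum.cong) auto
  then show ?thesis using True unfolding max_diff_def by simp
next
  case False
  then have "max_diff I (insert i S) x j k = max_diff I S x j k"
    unfolding max_diff_def by (intro sum.cong) auto
  then show ?thesis using False by (simp only: if_False diff_zero)
qed

lemma max_diff_antimono: "S \<subseteq> S' \<Longrightarrow> max_diff I S' x j k \<le> max_diff I S x j k"
  unfolding max_diff_def by (intro sum_mono) auto

text \<open>Once \<open>x i\<close> is fixed, testing \<open>i\<close> lowers only one of the two factors of a summand of the
  residual, which makes the product of the two supermodular.\<close>

lemma pair_submodular:
  fixes u u' w w' a a' :: int
  assumes "u' \<le> u" "w' \<le> w" "0 \<le> a" "0 \<le> a'" "a = 0 \<or> a' = 0"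
  shows "max 0 u' * max 0 w' - max 0 (u' - a) * max 0 (w' - a')
    \<le> max 0 u * max 0 w - max 0 (u - a) * max 0 (w - a')"
  using assms(5)
proof
  assume "a' = 0"
  have "(max 0 u' - max 0 (u' - a)) * max 0 w' \<le> (max 0 u - max 0 (u - a)) * max 0 w"
    using assms by (intro mult_mono) auto
  then show ?thesis using \<open>a' = 0\<close> by (simp add: left_diff_distrib)
next
  assume "a = 0"
  have "max 0 u' * (max 0 w' - max 0 (w' - a')) \<le> max 0 u * (max 0 w - max 0 (w - a'))"
    using assms by (intro mult_mono) auto
  then show ?thesis using \<open>a = 0\<close> by (simp add: right_diff_distrib)
qed

lemma residual_insert_le: "residual I (insert i S) x \<le> residual I S x"
  unfolding residual_def using max_diff_antimono[of S "insert i S" I x]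
  by (intro sum_mono mult_mono max.mono) auto

lemma residual_submodular:
  assumes "S \<subseteq> S'"
  shows "residual I S' x - residual I (insert i S') x \<le> residual I S x - residual I (insert i S) x"
proof (cases "i < num_vars I \<and> i \<notin> S'")
  case True
  then have i: "i < num_vars I" "i \<notin> S'" "i \<notin> S" using assms by auto
  \<comment> \<open>With \<open>d = coeff I j i - coeff I k i\<close>, the two factors lose
    \<open>max 0 d\<close> and \<open>max 0 (- d)\<close>, in an order determined by
    \<open>x i\<close>. One loss is 0, as \<open>pair_submodular\<close> requires.\<close>
  show ?thesis
    unfolding residual_def sum_subtractf[symmetric] max_diff_insert
    using i by (intro sum_mono) (simp only: simp_thms if_True,
      intro pair_submodular max_diff_antimono[OF assms], auto)
next
  case False
  then have "max_diff I (insert i S') x j k = max_diff I S' x j k" for j k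
    by (auto simp: max_diff_insert)
  then show ?thesis using residual_insert_le[of I i S x] by (simp add: residual_def)
qed

text \<open>With every variable known, the two maxima are a difference and its negative, so one of
  them is at most 0.\<close>

lemma residual_full:
  assumes "{..<num_vars I} \<subseteq> S"
  shows "residual I S x = 0"
proof -
  have "max_diff I S x k j = - max_diff I S x j k" for j k
    unfolding max_diff_def sum_negf[symmetric] using assms
    by (intro sum.cong) (auto simp: algebra_simps)
  then show ?thesis unfolding residual_eq_0_iff by (metis neg_le_0_iff_le linear)
qed

text \<open>The maximal excess of an earlier over a later function is attained by a consistent
  assignment, for which the list must still be sorted. Hence the tests of every correct strategy
  cover the residual.\<close>

lemma residual_known_ranking:
  assumes "known_ranking I S x js"
  shows "residual I S x = 0"
  unfolding residual_eq_0_iff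
proof (intro allI impI)
  fix j k assume jk: "j < num_funs I" "k < num_funs I"
  have js: "set js = {..<num_funs I}"
    and sorted: "\<And>x'. (\<forall>i\<in>S. x' i = x i) \<Longrightarrow> sorted (map (\<lambda>j. lin_fun I j x') js)"
    using assms unfolding known_ranking_def by blast+
  obtain a b where ab: "a < length js" "js ! a = j" "b < length js" "js ! b = k"
    using jk js in_set_conv_nth[of j js] in_set_conv_nth[of k js] by auto
  have le: "max_diff I S x (js ! a) (js ! b) \<le> 0" if "a \<le> b" "b < length js" for a b
  proof -
    obtain x' where x': "\<forall>i\<in>S. x' i = x i"
      "lin_fun I (js ! a) x' - lin_fun I (js ! b) x' = max_diff I S x (js ! a) (js ! b)"
      using max_diff_attained[of S x I "js ! a" "js ! b"] by (elim exE conjE)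
    have "lin_fun I (js ! a) x' \<le> lin_fun I (js ! b) x'"
      using sorted_nth_mono[OF sorted[OF x'(1)], of a b] that by simp
    then show ?thesis using x'(2) by simp
  qed
  show "max_diff I S x j k \<le> 0 \<or> max_diff I S x k j \<le> 0"
    using le[of a b] le[of b a] ab by (cases "a \<le> b") auto
qed

lemma sum_abs_coeff_le_D_max:
  "j < num_funs I \<Longrightarrow> (\<Sum>i<num_vars I. \<bar>coeff I j i\<bar>) \<le> int (D_max I)"
proof -
  assume j: "j < num_funs I"
  have "(\<Sum>i<num_vars I. nat \<bar>coeff I j i\<bar>) \<le> D_max I"
    unfolding D_max_def using j by (intro Max_ge) auto
  then have "int (\<Sum>i<num_vars I. nat \<bar>coeff I j i\<bar>) \<le> int (D_max I)" by (rule zle_int[THEN iffD2])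
  then show ?thesis by simp
qed

text \<open>The two maxima add up to the l1-distance of the coefficient rows, which is at most
  \<open>2 * D_max I\<close>. By the inequality of arithmetic and geometric means their product is
  at most the square of \<open>D_max I\<close>, and there are \<open>m * m\<close> pairs.\<close>

lemma residual_empty_le: "residual I {} x \<le> int ((num_funs I * D_max I)\<^sup>2)"
proof -
  have "max 0 (max_diff I {} x j k) * max 0 (max_diff I {} x k j) \<le> (int (D_max I))\<^sup>2"
    if "j < num_funs I" "k < num_funs I" for j k
  proof -
    define u w where "u = max_diff I {} x j k" and "w = max_diff I {} x k j"
    have nn: "0 \<le> u" "0 \<le> w" unfolding u_def w_def max_diff_def by (auto intro!: sum_nonneg)
    have "u + w = (\<Sum>i<num_vars I. \<bar>coeff I j i - coeff I k i\<bar>)"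
      unfolding u_def w_def max_diff_def sum.distrib[symmetric] by (intro sum.cong) auto
    also have "\<dots> \<le> (\<Sum>i<num_vars I. \<bar>coeff I j i\<bar> + \<bar>coeff I k i\<bar>)"
      by (intro sum_mono) auto
    also have "\<dots> \<le> 2 * int (D_max I)"
      using that[THEN sum_abs_coeff_le_D_max] by (simp add: sum.distrib)
    finally have "(u + w)\<^sup>2 \<le> (2 * int (D_max I))\<^sup>2"
      using nn by (intro power_mono) auto
    moreover have "4 * (u * w) \<le> (u + w)\<^sup>2"
      using zero_le_power2[of "u - w"] by (simp add: power2_eq_square algebra_simps)
    ultimately have "u * w \<le> (int (D_max I))\<^sup>2" by (simp add: power_mult_distrib)
    then show ?thesis using nn unfolding u_def w_def by simp
  qed
  then have "residual I {} x \<le> (\<Sum>j<num_funs I. \<Sum>k<num_funs I. (int (D_max I))\<^sup>2)"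
    unfolding residual_def by (intro sum_mono) auto
  then show ?thesis by (simp add: power2_eq_square algebra_simps)
qed

text \<open>In these cases the logarithm of the approximation factor may be 0, so greedy has to stop
  without testing. If the product is 1 there is a single function, and diagonal summands are
  0.\<close>

lemma residual_trivial:
  assumes "num_funs I * D_max I \<le> 1 \<or> num_funs I = 1"
  shows "residual I {} x = 0"
proof -
  consider "num_funs I * D_max I = 0" | "num_funs I = 1"
    using assms by (metis le_eq_less_or_eq less_one nat_mult_eq_1_iff)
  then show ?thesis
  proof cases
    case 1
    then show ?thesis using residual_empty_le[of I x] residual_nonneg[of I "{}" x] by auto
  next
    case 2
    then show ?thesis by (simp add: residual_def max_diff_self)
  qed
qed

text \<open>If every comparison is settled, sorting by \<open>rank_key\<close>, which is twice the expectation under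
  uniformly distributed untested variables, respects all of them: functions with equal keys then
  coincide on all consistent assignments.\<close>

definition rank_key :: "lfr \<Rightarrow> nat set \<Rightarrow> (nat \<Rightarrow> bool) \<Rightarrow> nat \<Rightarrow> int" where
  "rank_key I S x j = (\<Sum>i<num_vars I. if i \<in> S then 2 * coeff I j i * of_bool (x i) else coeff I j i)"

lemma max_diff_diff: "max_diff I S x j k - max_diff I S x k j = rank_key I S x j - rank_key I S x k"
  unfolding max_diff_def rank_key_def sum_subtractf[symmetric]
  by (intro sum.cong) (auto simp: algebra_simps)

text \<open>Phrased with the two maxima that the program has at hand. It amounts to comparing
  \<open>rank_key\<close> with ties broken by index, hence it is a strict total order.\<close>

definition rank_before :: "lfr \<Rightarrow> nat set \<Rightarrow> (nat \<Rightarrow> bool) \<Rightarrow> nat \<Rightarrow> nat \<Rightarrow> bool" where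
  "rank_before I S x k j \<longleftrightarrow>
    max_diff I S x k j < max_diff I S x j k \<or> max_diff I S x k j = max_diff I S x j k \<and> k < j"

lemma rank_before_iff:
  "rank_before I S x k j \<longleftrightarrow>
    rank_key I S x k < rank_key I S x j \<or> rank_key I S x k = rank_key I S x j \<and> k < j"
  unfolding rank_before_def using max_diff_diff[of I S x j k] by auto

definition position :: "lfr \<Rightarrow> nat set \<Rightarrow> (nat \<Rightarrow> bool) \<Rightarrow> nat \<Rightarrow> nat" where
  "position I S x j = card {k. k < num_funs I \<and> rank_before I S x k j}"

definition ranking :: "lfr \<Rightarrow> nat set \<Rightarrow> (nat \<Rightarrow> bool) \<Rightarrow> nat list" where
  "ranking I S x = map (inv_into {..<num_funs I} (position I S x)) [0..<num_funs I]"

lemma position_mono: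
  assumes "j < num_funs I" "rank_before I S x j k"
  shows "position I S x j < position I S x k"
  unfolding position_def
proof (rule psubset_card_mono)
  have "j \<notin> {l. l < num_funs I \<and> rank_before I S x l j}" by (simp add: rank_before_iff)
  moreover have "j \<in> {l. l < num_funs I \<and> rank_before I S x l k}" using assms by simp
  moreover have "{l. l < num_funs I \<and> rank_before I S x l j} \<subseteq> {l. l < num_funs I \<and> rank_before I S x l k}"
    using assms(2) by (auto simp: rank_before_iff)
  ultimately show "{l. l < num_funs I \<and> rank_before I S x l j} \<subset> {l. l < num_funs I \<and> rank_before I S x l k}"
    by blast
qed simp

lemma rank_before_total: "j \<noteq> k \<Longrightarrow> rank_before I S x j k \<or> rank_before I S x k j"
  unfolding rank_before_iff by auto

lemma position_less:
  assumes "j < num_funs I"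
  shows "position I S x j < num_funs I"
proof -
  have "{k. k < num_funs I \<and> rank_before I S x k j} \<subseteq> {..<num_funs I} - {j}"
    by (auto simp: rank_before_iff)
  then have "position I S x j \<le> card ({..<num_funs I} - {j})"
    unfolding position_def by (intro card_mono) auto
  then show ?thesis using assms by simp
qed

lemma bij_position: "bij_betw (position I S x) {..<num_funs I} {..<num_funs I}"
proof -
  have "inj_on (position I S x) {..<num_funs I}"
    by (rule inj_onI) (metis lessThan_iff less_irrefl position_mono rank_before_total)
  moreover have "position I S x ` {..<num_funs I} \<subseteq> {..<num_funs I}"
    using position_less by auto
  ultimately show ?thesis
    using endo_inj_surj[of "{..<num_funs I}"] by (auto simp: bij_betw_def)
qed

lemma ranking_cong:
  assumes "\<And>i. i \<in> S \<Longrightarrow> x i = y i"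
  shows "ranking I S x = ranking I S y"
proof -
  have "max_diff I S x = max_diff I S y" using max_diff_cong[of S x y] assms by blast
  then show ?thesis unfolding ranking_def position_def rank_before_def by simp
qed

lemma known_ranking_ranking:
  assumes "residual I S x = 0"
  shows "known_ranking I S x (ranking I S x)"
  unfolding known_ranking_def
proof (intro conjI allI impI)
  let ?m = "num_funs I" and ?inv = "inv_into {..<num_funs I} (position I S x)"
  have bij: "bij_betw ?inv {..<?m} {..<?m}"
    using bij_position by (rule bij_betw_inv_into)
  then show "distinct (ranking I S x)"
    unfolding ranking_def distinct_map by (simp add: bij_betw_def atLeast0LessThan)
  show "set (ranking I S x) = {..<?m}"
    using bij unfolding ranking_def by (simp add: bij_betw_def atLeast0LessThan)
  fix x' assume x': "\<forall>i\<in>S. x' i = x i"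
  show "sorted (map (\<lambda>j. lin_fun I j x') (ranking I S x))"
    unfolding sorted_iff_nth_mono_less
  proof (intro allI impI)
    fix a b assume ab: "a < b" "b < length (map (\<lambda>j. lin_fun I j x') (ranking I S x))"
    then have b: "b < ?m" "a < ?m" by (auto simp: ranking_def)
    define j k where "j = ?inv a" and "k = ?inv b"
    have jk: "j < ?m" "k < ?m" "position I S x j = a" "position I S x k = b"
      using bij_betw_inv_into_right[OF bij_position] bij b
      unfolding j_def k_def by (auto dest: bij_betwE)
    have "\<not> rank_before I S x k j"
      using position_mono[OF jk(2), of S x j] jk ab by auto
    \<comment> \<open>A vanishing residual makes the smaller of the two maxima at most 0, so no
      consistent assignment puts function \<open>j\<close> above function \<open>k\<close>.\<close>
    then have "max_diff I S x j k \<le> max_diff I S x k j" unfolding rank_before_def by auto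
    then have "max_diff I S x j k \<le> 0"
      using assms jk(1,2) unfolding residual_eq_0_iff by force
    then have "lin_fun I j x' \<le> lin_fun I k x'"
      using max_diff_upper[of S x' x I j k] x' by simp
    then show "map (\<lambda>j. lin_fun I j x') (ranking I S x) ! a \<le> map (\<lambda>j. lin_fun I j x') (ranking I S x) ! b"
      using b by (simp add: ranking_def j_def k_def)
  qed
qed

text \<open>Whether a decision tree tests \<open>i\<close> is settled before it first reads
  \<open>x i\<close>. This provides the hypothesis \<open>flip\<close> of
  \<open>greedy_cost_le\<close>.\<close>

lemma tests_flip: "i \<in> set (tests T (x(i := b))) \<longleftrightarrow> i \<in> set (tests T x)"
  by (induction T) auto

text \<open>A strategy may repeat a test and pay for it again, whereas the dual bound charges each
  variable once.\<close>

lemma sum_set_le_sum_list: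
  fixes f :: "'a \<Rightarrow> real"
  assumes "\<And>a. a \<in> set xs \<Longrightarrow> 0 \<le> f a"
  shows "(\<Sum>a\<in>set xs. f a) \<le> (\<Sum>a\<leftarrow>xs. f a)"
  using assms
proof (induction xs)
  case (Cons a xs)
  then show ?case by (cases "a \<in> set xs") (simp_all add: insert_absorb add_increasing)
qed simp

section \<open>The greedy strategy as a decision tree\<close>

locale lfr_problem =
  fixes I :: lfr
  assumes inst: "lfr_instance I"

sublocale lfr_problem \<subseteq>
  stochastic_submodular_cover "num_vars I" "prob_one I" "test_cost I" "residual I"
  using inst
  by unfold_locales
    (auto simp: lfr_instance_def residual_nonneg residual_insert_le residual_submodular residual_full
      intro: residual_cong)

context lfr_problem
begin

text \<open>The first argument is fuel that makes the recursion structural; \<open>y\<close> records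
  the outcomes along the branch.\<close>

primrec greedy_strategy :: "nat \<Rightarrow> nat set \<Rightarrow> (nat \<Rightarrow> bool) \<Rightarrow> strategy" where
  "greedy_strategy 0 S y = Output (ranking I S y)"
| "greedy_strategy (Suc f) S y =
    (if residual I S y = 0 then Output (ranking I S y)
     else let i = best S y in
       Test i (greedy_strategy f (insert i S) (y(i := False)))
         (greedy_strategy f (insert i S) (y(i := True))))"

primrec greedy_tests :: "nat \<Rightarrow> nat set \<Rightarrow> (nat \<Rightarrow> bool) \<Rightarrow> nat list" where
  "greedy_tests 0 S x = []"
| "greedy_tests (Suc f) S x =
    (if residual I S x = 0 then [] else best S x # greedy_tests f (insert (best S x) S) x)"

lemma greedy_strategy_path:
  assumes "\<And>i. i \<in> S \<Longrightarrow> y i = x i"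
  shows "tests (greedy_strategy f S y) x = greedy_tests f S x \<and>
    answer (greedy_strategy f S y) x = ranking I (S \<union> set (greedy_tests f S x)) x"
  using assms
proof (induction f arbitrary: S y)
  case 0
  then show ?case using ranking_cong[of S y x I] by simp
next
  case (Suc f)
  have eq: "residual I S y = residual I S x" "best S y = best S x" "ranking I S y = ranking I S x"
    using Suc.prems residual_cong[of S y x] best_cong[of S y x] ranking_cong[of S y x] by auto
  let ?i = "best S x"
  have "tests (greedy_strategy f (insert ?i S) (y(?i := b))) x = greedy_tests f (insert ?i S) x \<and>
      answer (greedy_strategy f (insert ?i S) (y(?i := b))) x =
        ranking I (insert ?i S \<union> set (greedy_tests f (insert ?i S) x)) x" if "b = x ?i" for b
    using Suc.prems that by (intro Suc.IH) auto
  from this[of True] this[of False] show ?case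
    by (cases "x ?i") (simp_all add: eq Let_def)
qed

text \<open>Each test adds a new variable to \<open>S\<close>, so when the fuel is exhausted all
  variables are tested and the residual is 0.\<close>

lemma greedy_tests_complete:
  assumes "S \<subseteq> {..<num_vars I}" "num_vars I \<le> card S + f"
  shows "set (greedy_tests f S x) \<subseteq> {..<num_vars I} \<and>
    residual I (S \<union> set (greedy_tests f S x)) x = 0"
  using assms
proof (induction f arbitrary: S)
  case 0
  then have "S = {..<num_vars I}"
    using card_seteq[of "{..<num_vars I}" S] by simp
  then show ?case using residual_full by simp
next
  case (Suc f)
  show ?case
  proof (cases "residual I S x = 0")
    case False
    then have "0 < residual I S x" using residual_nonneg[of I S x] by simp
    note b = best(1,2)[OF this]
    have "card (insert (best S x) S) = Suc (card S)"
      using b finite_subset[OF Suc.prems(1)] by simp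
    then show ?thesis
      using Suc.IH[of "insert (best S x) S"] Suc.prems b False by simp
  qed simp
qed

abbreviation greedy :: strategy where
  "greedy \<equiv> greedy_strategy (num_vars I) {} (\<lambda>_. False)"

lemma ranking_strategy_greedy: "ranking_strategy I greedy"
  unfolding ranking_strategy_def
  using greedy_strategy_path[of "{}"] greedy_tests_complete[of "{}" "num_vars I"]
    known_ranking_ranking by simp

lemma greedy_tests_cost:
  assumes "t + f = num_vars I"
  shows "(\<Sum>i\<leftarrow>greedy_tests f (run t x) x. test_cost I i) =
    (\<Sum>s\<in>{t..<num_vars I}. if active s x then test_cost I (best (run s x) x) else 0)"
  using assms
proof (induction f arbitrary: t)
  case (Suc f)
  show ?case
  proof (cases "active t x")
    case True
    then have "run (Suc t) x = insert (best (run t x) x) (run t x)" "residual I (run t x) x \<noteq> 0"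
      using run_active by (auto simp: active_def)
    then show ?thesis
      using Suc.IH[of "Suc t"] Suc.prems True
      by (simp add: sum.atLeast_Suc_lessThan del: run.simps)
  next
    case False
    then have "\<not> active s x" if "t \<le> s" for s using that active_antimono by blast
    then show ?thesis using not_active[OF False] by simp
  qed
qed simp

lemma expected_cost_greedy: "expected_cost I greedy = Ex greedy_cost"
proof -
  have "(\<Sum>i\<leftarrow>tests greedy x. test_cost I i) = greedy_cost x" for x
    using greedy_strategy_path[of "{}"] greedy_tests_cost[of 0 "num_vars I" x]
    unfolding greedy_cost_def by (simp add: atLeast0LessThan)
  then show ?thesis unfolding expected_cost_def assignment_pmf_def by simp
qed

lemma expected_cost_greedy_le:
  assumes "ranking_strategy I T" "1 \<le> Q" "\<And>x. real_of_int (residual I {} x) \<le> Q"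
  shows "expected_cost I greedy \<le> 2 * (1 + ln Q) * expected_cost I T"
proof -
  have T: "set (tests T x) \<subseteq> {..<num_vars I}" "residual I (set (tests T x)) x = 0" for x
    using assms(1) residual_known_ranking unfolding ranking_strategy_def by blast+
  have "expected_cost I greedy \<le> 2 * (1 + ln Q) * Ex (\<lambda>x. \<Sum>i\<in>set (tests T x). test_cost I i)"
    unfolding expected_cost_greedy using T tests_flip assms(2,3) by (intro greedy_cost_le) auto
  also have "\<dots> \<le> 2 * (1 + ln Q) * Ex (\<lambda>x. \<Sum>i\<leftarrow>tests T x. test_cost I i)"
  proof (intro mult_left_mono Ex_mono sum_set_le_sum_list)
    fix x i assume "i \<in> set (tests T x)"
    then show "0 \<le> test_cost I i" using T(1)[of x] cost by auto
  qed (use assms(2) in simp)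
  finally show ?thesis unfolding expected_cost_def assignment_pmf_def .
qed

lemma expected_cost_greedy_le_opt:
  "expected_cost I greedy \<le> 8 * ln (real (num_funs I * D_max I)) * opt_cost I"
proof -
  let ?N = "num_funs I * D_max I"
  have ne: "{S. ranking_strategy I S} \<noteq> {}" using ranking_strategy_greedy by blast
  have opt_ge: "0 \<le> opt_cost I"
    unfolding opt_cost_def using ne expected_cost_nonneg[OF inst] by (intro cINF_greatest) auto
  show ?thesis
  proof (cases "?N \<le> 1 \<or> num_funs I = 1")
    case True
    then have "residual I (run t x) x = 0" for t x
      using residual_trivial[of I x] by (induction t) auto
    then have "expected_cost I greedy = 0"
      unfolding expected_cost_greedy greedy_cost_def active_def by simp
    moreover have "0 \<le> ln (real ?N)" by (cases "?N = 0") (auto simp del: of_nat_mult)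
    ultimately show ?thesis using opt_ge by simp
  next
    case False
    then have N: "2 \<le> ?N" by simp
    define Q where "Q = real (?N\<^sup>2)"
    have lnQ: "ln Q = 2 * ln (real ?N)"
      unfolding Q_def using N by (simp add: ln_realpow del: of_nat_mult)
    have Q1: "1 \<le> Q" unfolding Q_def using N one_le_power[of ?N 2] by linarith
    have resQ: "real_of_int (residual I {} x) \<le> Q" for x
      using residual_empty_le[of I x] unfolding Q_def by linarith
    have pos: "0 < 2 * (1 + ln Q)" using Q1 by (simp add: add_pos_nonneg)
    \<comment> \<open>The optimum is an infimum, so greedy is compared with every strategy and the
      factor is moved to the left first.\<close>
    have "expected_cost I greedy / (2 * (1 + ln Q)) \<le> opt_cost I"
      unfolding opt_cost_def using ne expected_cost_greedy_le[OF _ Q1 resQ] pos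
      by (intro cINF_greatest) (auto simp: pos_divide_le_eq mult.commute)
    then have "expected_cost I greedy \<le> 2 * (1 + ln Q) * opt_cost I"
      using pos by (simp add: pos_divide_le_eq mult.commute)
    also have "\<dots> \<le> 8 * ln (real ?N) * opt_cost I"
    proof (intro mult_right_mono opt_ge)
      \<comment> \<open>With \<open>L = ln (real ?N)\<close> the factor is \<open>2 + 4 * L\<close>,
        which is at most \<open>8 * L\<close> as soon as \<open>L \<ge> 1 / 2\<close>.\<close>
      have "2 / 3 \<le> ln (2 :: real)" by (rule ln2_ge_two_thirds)
      also have "\<dots> \<le> ln (real ?N)" using N by (subst ln_le_cancel_iff) linarith+
      finally show "2 * (1 + ln Q) \<le> 8 * ln (real ?N)" unfolding lnQ by simp
    qed
    finally show ?thesis .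
  qed
qed

end

section \<open>The program\<close>

text \<open>Total correctness with a postcondition on time and test trace; as \<open>exec\<close> is
  deterministic, one terminating execution describes the behaviour completely.\<close>

definition wp :: "(nat \<Rightarrow> bool) \<Rightarrow> com \<Rightarrow> (nat \<Rightarrow> nat list \<Rightarrow> state \<Rightarrow> bool) \<Rightarrow> state \<Rightarrow> bool" where
  "wp x P Q s \<longleftrightarrow> (\<exists>t is s'. exec x P s t is s' \<and> Q t is s')"

lemma wp_mono:
  "wp x P Q s \<Longrightarrow> (\<And>t is s'. Q t is s' \<Longrightarrow> Q' t is s') \<Longrightarrow> wp x P Q' s"
  unfolding wp_def by blast

lemma wp_Skip: "Q 1 [] s \<Longrightarrow> wp x Skip Q s"
  unfolding wp_def by (blast intro: exec.Skip)

lemma wp_IAssign: "Q 1 [] (iupd v (ival e1 s) (ival e2 s) s) \<Longrightarrow> wp x (IAssign v e1 e2) Q s"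
  unfolding wp_def by (blast intro: exec.IAssign)

lemma wp_RAssign: "Q 1 [] (rupd v (ival e1 s) (rval e2 s) s) \<Longrightarrow> wp x (RAssign v e1 e2) Q s"
  unfolding wp_def by (blast intro: exec.RAssign)

lemma wp_Query:
  "ival e2 s = int i \<Longrightarrow> Q 1 [i] (iupd v (ival e1 s) (of_bool (x i)) s) \<Longrightarrow> wp x (Query v e1 e2) Q s"
  unfolding wp_def by (blast intro: exec.Query)

lemma wp_Seq:
  "wp x P (\<lambda>t is. wp x P' (\<lambda>t' is'. Q (t + t') (is @ is'))) s \<Longrightarrow> wp x (Seq P P') Q s"
  unfolding wp_def by (blast intro: exec.Seq)

lemma wp_Cond:
  assumes "bval b s \<Longrightarrow> wp x P (\<lambda>t. Q (t + 1)) s" "\<not> bval b s \<Longrightarrow> wp x P' (\<lambda>t. Q (t + 1)) s"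
  shows "wp x (Cond b P P') Q s"
  using assms unfolding wp_def by (cases "bval b s") (blast intro: exec.CondTrue exec.CondFalse)+

lemmas wp_intros = wp_Skip wp_IAssign wp_RAssign wp_Seq wp_Cond

abbreviation var :: "string \<Rightarrow> iexp" where
  "var v \<equiv> ICell v (IConst 0)"

abbreviation rvar :: "string \<Rightarrow> rexp" where
  "rvar v \<equiv> RCell v (IConst 0)"

abbreviation iset :: "string \<Rightarrow> iexp \<Rightarrow> com" where
  "iset v e \<equiv> IAssign v (IConst 0) e"

abbreviation rset :: "string \<Rightarrow> rexp \<Rightarrow> com" where
  "rset v e \<equiv> RAssign v (IConst 0) e"

definition For :: "string \<Rightarrow> iexp \<Rightarrow> com \<Rightarrow> com" where
  "For v b P = Seq (iset v (IConst 0))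
     (While (ILess (var v) b) (Seq P (iset v (IAdd (var v) (IConst 1)))))"

text \<open>For loops whose body tests no variable. Each round pays for the body, the guard and the
  increment; the final 2 pays for the initialisation and the failing guard.\<close>

lemma wp_For:
  assumes init: "Inv 0 (iupd v 0 0 s)"
    and count: "\<And>l s. Inv l s \<Longrightarrow> imem s v 0 = int l \<and> ival b s = int N"
    and step: "\<And>l s. l < N \<Longrightarrow> Inv l s \<Longrightarrow>
      wp x P (\<lambda>t is s'. is = [] \<and> t \<le> T \<and> Inv (Suc l) (iupd v 0 (imem s' v 0 + 1) s')) s"
    and post: "\<And>t s'. Inv N s' \<Longrightarrow> t \<le> N * (T + 2) + 2 \<Longrightarrow> Q t [] s'"
  shows "wp x (For v b P) Q s"
proof -
  let ?W = "While (ILess (var v) b) (Seq P (iset v (IAdd (var v) (IConst 1))))"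
  have "\<exists>t s'. exec x ?W s t [] s' \<and> t \<le> d * (T + 2) + 1 \<and> Inv N s'"
    if "Inv l s" "l + d = N" for d l s
    using that
  proof (induction d arbitrary: l s)
    case 0
    then have "\<not> bval (ILess (var v) b) s" using count[of l s] by simp
    then have "exec x ?W s 1 [] s" by (rule exec.WhileFalse)
    then show ?case using 0 by (intro exI[of _ 1] exI[of _ s]) simp
  next
    case (Suc d)
    have b: "bval (ILess (var v) b) s" using count[OF Suc.prems(1)] Suc.prems(2) by simp
    obtain t s' where t: "exec x P s t [] s'" "t \<le> T" "Inv (Suc l) (iupd v 0 (imem s' v 0 + 1) s')"
      using step[OF _ Suc.prems(1)] Suc.prems(2) unfolding wp_def by auto
    have body: "exec x (Seq P (iset v (IAdd (var v) (IConst 1)))) s (t + 1) ([] @ [])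
        (iupd v 0 (imem s' v 0 + 1) s')"
      using exec.Seq[OF t(1) exec.IAssign, of v "IConst 0" "IAdd (var v) (IConst 1)"] by simp
    obtain t2 s2 where t2: "exec x ?W (iupd v 0 (imem s' v 0 + 1) s') t2 [] s2"
      "t2 \<le> d * (T + 2) + 1" "Inv N s2"
      using Suc.IH[OF t(3)] Suc.prems(2) by auto
    have "exec x ?W s (t + 1 + t2 + 1) [] s2"
      using exec.WhileTrue[OF b body t2(1)] by simp
    then show ?case using t(2) t2(2,3) by (intro exI[of _ "t + 1 + t2 + 1"] exI[of _ s2]) simp
  qed
  from this[OF init, of N] obtain t s' where
    t: "exec x ?W (iupd v 0 0 s) t [] s'" "t \<le> N * (T + 2) + 1" "Inv N s'" by auto
  have "exec x (iset v (IConst 0)) s 1 [] (iupd v 0 0 s)"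
    using exec.IAssign[of x v "IConst 0" "IConst 0" s] by simp
  from exec.Seq[OF this t(1)] have "exec x (For v b P) s (1 + t) [] s'"
    unfolding For_def by simp
  moreover have "Q (1 + t) [] s'" using t(2) by (intro post[OF t(3)]) simp
  ultimately show ?thesis unfolding wp_def by blast
qed

lemma imem_iupd [simp]: "imem (iupd v k z s) w l = (if w = v \<and> l = k then z else imem s w l)"
  by (simp add: iupd_def)

lemma rmem_iupd [simp]: "rmem (iupd v k z s) = rmem s"
  by (simp add: iupd_def)

lemma imem_rupd [simp]: "imem (rupd v k z s) = imem s"
  by (simp add: rupd_def)

lemma rmem_rupd [simp]: "rmem (rupd v k z s) w l = (if w = v \<and> l = k then z else rmem s w l)"
  by (simp add: rupd_def)

section \<open>Frame conditions and representation of the tested set\<close>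

definition keeps :: "string set \<Rightarrow> state \<Rightarrow> state \<Rightarrow> bool" where
  "keeps V s s' \<longleftrightarrow> (\<forall>v k. v \<notin> V \<longrightarrow> imem s' v k = imem s v k \<and> rmem s' v k = rmem s v k)"

lemma keeps_refl: "keeps V s s"
  by (simp add: keeps_def)

lemma keeps_trans: "keeps V s s' \<Longrightarrow> keeps V' s' s'' \<Longrightarrow> V' \<subseteq> V \<Longrightarrow> keeps V s s''"
  unfolding keeps_def by (metis subsetD)

lemma keeps_iupd: "keeps V s s' \<Longrightarrow> v \<in> V \<Longrightarrow> keeps V s (iupd v k z s')"
  by (auto simp: keeps_def)

lemma keeps_rupd: "keeps V s s' \<Longrightarrow> v \<in> V \<Longrightarrow> keeps V s (rupd v k z s')"
  by (auto simp: keeps_def)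

lemma keeps_imem: "keeps V s s' \<Longrightarrow> v \<notin> V \<Longrightarrow> imem s' v k = imem s v k"
  by (auto simp: keeps_def)

lemma keeps_rmem: "keeps V s s' \<Longrightarrow> v \<notin> V \<Longrightarrow> rmem s' v k = rmem s v k"
  by (auto simp: keeps_def)

text \<open>The arrays \<open>s\<close> and \<open>v\<close> hold the set \<open>S\<close> of tested variables and their values.\<close>

definition rep :: "lfr \<Rightarrow> nat set \<Rightarrow> (nat \<Rightarrow> bool) \<Rightarrow> state \<Rightarrow> bool" where
  "rep I S y s \<longleftrightarrow>
    imem s ''m'' 0 = int (num_funs I) \<and> imem s ''n'' 0 = int (num_vars I) \<and>
    (\<forall>j<num_funs I. \<forall>i<num_vars I. imem s ''a'' (int j * int (num_vars I) + int i) = coeff I j i) \<and>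
    (\<forall>i<num_vars I. imem s ''s'' (int i) = of_bool (i \<in> S) \<and>
       (i \<in> S \<longrightarrow> imem s ''v'' (int i) = of_bool (y i)) \<and>
       rmem s ''p'' (int i) = prob_one I i \<and> rmem s ''c'' (int i) = test_cost I i)"

lemma rep_keeps:
  assumes "keeps V s s'" "rep I S y s" "V \<inter> {''m'', ''n'', ''a'', ''s'', ''v'', ''p'', ''c''} = {}"
  shows "rep I S y s'"
proof -
  have "''m'' \<notin> V" "''n'' \<notin> V" "''a'' \<notin> V" "''s'' \<notin> V" "''v'' \<notin> V" "''p'' \<notin> V" "''c'' \<notin> V"
    using assms(3) by auto
  then show ?thesis
    using assms(2) unfolding rep_def
    by (simp only: keeps_imem[OF assms(1)] keeps_rmem[OF assms(1)] simp_thms) blast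
qed

text \<open>\<open>J\<close> and \<open>K\<close> hold the row offsets \<open>j * n\<close> and \<open>k * n\<close>, maintained by repeated addition because the
  machine does not multiply integers.\<close>

abbreviation coeff_diff :: iexp where
  "coeff_diff \<equiv> ISub (ICell ''a'' (IAdd (var ''J'') (var ''i''))) (ICell ''a'' (IAdd (var ''K'') (var ''i'')))"

section \<open>Evaluation of the residual and of the positions\<close>

definition pair_body :: com where
  "pair_body =
    Cond (ILess (IConst 0) (ICell ''s'' (var ''i'')))
      (Cond (ILess (IConst 0) (ICell ''v'' (var ''i'')))
        (Seq (iset ''M'' (IAdd (var ''M'') coeff_diff)) (iset ''N'' (ISub (var ''N'') coeff_diff)))
        Skip)
      (Cond (ILess (IConst 0) coeff_diff)
        (iset ''M'' (IAdd (var ''M'') coeff_diff))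
        (iset ''N'' (ISub (var ''N'') coeff_diff)))"

definition pair_loop :: com where
  "pair_loop = For ''i'' (var ''n'') pair_body"

text \<open>One pass accumulates both maxima: an untested variable feeds only the sum in which its
  difference is nonnegative, a tested one feeds both with opposite signs or, if its value is 0,
  neither.\<close>

lemma wp_pair_loop:
  assumes "rep I S y s" "j < num_funs I" "k < num_funs I"
    and "imem s ''J'' 0 = int j * int (num_vars I)" "imem s ''K'' 0 = int k * int (num_vars I)"
    and "imem s ''M'' 0 = 0" "imem s ''N'' 0 = 0"
  shows "wp x pair_loop (\<lambda>t is s'. is = [] \<and> t \<le> 6 * num_vars I + 2 \<and> keeps {''i'', ''M'', ''N''} s s' \<and>
    imem s' ''M'' 0 = max_diff I S y j k \<and> imem s' ''N'' 0 = max_diff I S y k j) s"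
proof -
  define d where "d j k i = (if i \<in> S then (coeff I j i - coeff I k i) * of_bool (y i)
    else max 0 (coeff I j i - coeff I k i))" for j k i
  define Inv where "Inv l s' \<longleftrightarrow> keeps {''i'', ''M'', ''N''} s s' \<and> imem s' ''i'' 0 = int l \<and>
    imem s' ''M'' 0 = (\<Sum>i<l. d j k i) \<and> imem s' ''N'' 0 = (\<Sum>i<l. d k j i)" for l s'
  have Inv_rep: "rep I S y s'" "imem s' ''J'' 0 = int j * int (num_vars I)"
    "imem s' ''K'' 0 = int k * int (num_vars I)" if "Inv l s'" for l s'
    using that assms unfolding Inv_def by (auto elim!: rep_keeps simp: keeps_imem)
  show ?thesis
    unfolding pair_loop_def
  proof (rule wp_For[where N = "num_vars I" and T = 4 and Inv = Inv])
    show "Inv 0 (iupd ''i'' 0 0 s)"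
      using assms by (simp add: Inv_def keeps_iupd keeps_refl)
  next
    fix l s' assume inv: "Inv l s'"
    then show "imem s' ''i'' 0 = int l \<and> ival (var ''n'') s' = int (num_vars I)"
      using Inv_rep[OF inv] by (simp add: Inv_def rep_def)
  next
    fix l s' assume l: "l < num_vars I" and inv: "Inv l s'"
    note r = Inv_rep[OF inv]
    have a: "imem s' ''a'' (int j * int (num_vars I) + int l) = coeff I j l"
      "imem s' ''a'' (int k * int (num_vars I) + int l) = coeff I k l"
      "imem s' ''s'' (int l) = of_bool (l \<in> S)" "l \<in> S \<Longrightarrow> imem s' ''v'' (int l) = of_bool (y l)"
      using r(1) l assms(2,3) unfolding rep_def by blast+
    show "wp x pair_body (\<lambda>t is s''. is = [] \<and> t \<le> 4 \<and>
        Inv (Suc l) (iupd ''i'' 0 (imem s'' ''i'' 0 + 1) s'')) s'"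
      unfolding pair_body_def
      using inv r(2,3) a
      by (cases "l \<in> S"; cases "y l"; cases "0 < coeff I j l - coeff I k l"; intro wp_intros;
        simp add: Inv_def d_def keeps_iupd)
  next
    fix t s' assume "Inv (num_vars I) s'" "t \<le> num_vars I * (4 + 2) + 2"
    then show "[] = [] \<and> t \<le> 6 * num_vars I + 2 \<and> keeps {''i'', ''M'', ''N''} s s' \<and>
      imem s' ''M'' 0 = max_diff I S y j k \<and> imem s' ''N'' 0 = max_diff I S y k j"
      unfolding Inv_def d_def max_diff_def by simp
  qed
qed


text \<open>The second conditional is \<open>rank_before\<close> for \<open>k\<close> and
  \<open>j\<close>, with the disjunction expressed by negations and conjunction; counting its
  successes gives the position of \<open>j\<close>.\<close>

definition row_body :: com where
  "row_body = Seq (iset ''M'' (IConst 0)) (Seq (iset ''N'' (IConst 0)) (Seq pair_loop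
    (Seq (Cond (BAnd (ILess (IConst 0) (var ''M'')) (ILess (IConst 0) (var ''N'')))
        (rset ''f'' (RAdd (rvar ''f'') (RMul (ROfInt (var ''M'')) (ROfInt (var ''N'')))))
        Skip)
    (Seq (Cond (BAnd (BNot (ILess (var ''M'') (var ''N'')))
          (BNot (BAnd (BNot (ILess (var ''N'') (var ''M''))) (BNot (ILess (var ''k'') (var ''j''))))))
        (iset ''r'' (IAdd (var ''r'') (IConst 1)))
        Skip)
      (iset ''K'' (IAdd (var ''K'') (var ''n'')))))))"

definition row_loop :: com where
  "row_loop = For ''k'' (var ''m'') row_body"

abbreviation row_vars :: "string set" where
  "row_vars \<equiv> {''i'', ''k'', ''K'', ''M'', ''N'', ''r'', ''f''}"

lemma wp_row_loop:
  assumes "rep I S y s" "j < num_funs I"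
    and "imem s ''j'' 0 = int j" "imem s ''J'' 0 = int j * int (num_vars I)"
    and "imem s ''K'' 0 = 0" "imem s ''r'' 0 = 0"
  shows "wp x row_loop (\<lambda>t is s'. is = [] \<and> t \<le> num_funs I * (6 * num_vars I + 11) + 2 \<and>
    keeps row_vars s s' \<and> imem s' ''r'' 0 = int (position I S y j) \<and>
    rmem s' ''f'' 0 = rmem s ''f'' 0 +
      of_int (\<Sum>k<num_funs I. max 0 (max_diff I S y j k) * max 0 (max_diff I S y k j))) s"
proof -
  let ?n = "num_vars I" and ?m = "num_funs I" and ?M = "max_diff I S y"
  define Inv where "Inv l s' \<longleftrightarrow> keeps row_vars s s' \<and> imem s' ''k'' 0 = int l \<and>
    imem s' ''K'' 0 = int l * int ?n \<and>
    imem s' ''r'' 0 = int (card {k. k < l \<and> rank_before I S y k j}) \<and>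
    rmem s' ''f'' 0 = rmem s ''f'' 0 + of_int (\<Sum>k<l. max 0 (?M j k) * max 0 (?M k j))" for l s'
  have Inv_rep: "rep I S y s'" "imem s' ''J'' 0 = int j * int ?n" "imem s' ''j'' 0 = int j"
    if "Inv l s'" for l s'
    using that assms unfolding Inv_def by (auto elim!: rep_keeps simp: keeps_imem)
  show ?thesis
    unfolding row_loop_def
  proof (rule wp_For[where N = ?m and T = "6 * ?n + 9" and Inv = Inv])
    show "Inv 0 (iupd ''k'' 0 0 s)"
      using assms by (simp add: Inv_def keeps_iupd keeps_refl)
  next
    fix l s' assume inv: "Inv l s'"
    then show "imem s' ''k'' 0 = int l \<and> ival (var ''m'') s' = int ?m"
      using Inv_rep[OF inv] by (simp add: Inv_def rep_def)
  next
    fix l s1 assume l: "l < ?m" and inv: "Inv l s1"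
    note r = Inv_rep[OF inv]
    have card: "card {k. k < Suc l \<and> rank_before I S y k j} =
        card {k. k < l \<and> rank_before I S y k j} + of_bool (rank_before I S y l j)"
    proof -
      have eq: "{k. k < Suc l \<and> rank_before I S y k j} = {k. k < l \<and> rank_before I S y k j} \<union>
          (if rank_before I S y l j then {l} else {})"
        by (auto simp: less_Suc_eq)
      show ?thesis unfolding eq by (subst card_Un_disjoint) auto
    qed
    show "wp x row_body (\<lambda>t is s''. is = [] \<and> t \<le> 6 * ?n + 9 \<and>
        Inv (Suc l) (iupd ''k'' 0 (imem s'' ''k'' 0 + 1) s'')) s1"
      unfolding row_body_def
    proof (intro wp_intros, rule wp_mono[OF wp_pair_loop[where I = I and S = S and y = y and j = j and k = l]],
        goal_cases)
      case 1
      show ?case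
        using r(1) by (rule rep_keeps[rotated, where V = row_vars]) (auto simp: keeps_def)
    next
      \<comment> \<open>Goals 1 to 7 are the preconditions of the inner loop; this one is the code
        that follows it.\<close>
      case (8 t "is" s2)
      define s1' where "s1' = iupd ''N'' 0 0 (iupd ''M'' 0 0 s1)"
      have k2: "keeps row_vars s s2"
      proof (rule keeps_trans)
        show "keeps row_vars s s1'"
          using inv unfolding Inv_def s1'_def by (simp add: keeps_iupd)
        show "keeps {''i'', ''M'', ''N''} s1' s2" using 8 unfolding s1'_def by simp
      qed simp
      have k12: "keeps {''i'', ''M'', ''N''} s1 s2"
      proof (rule keeps_trans)
        show "keeps {''i'', ''M'', ''N''} s1 s1'"
          unfolding s1'_def by (simp add: keeps_iupd keeps_refl)
        show "keeps {''i'', ''M'', ''N''} s1' s2" using 8 unfolding s1'_def by simp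
      qed simp
      have v: "imem s2 ''k'' 0 = int l" "imem s2 ''j'' 0 = int j" "imem s2 ''K'' 0 = int l * int ?n"
        "imem s2 ''n'' 0 = int ?n"
        "imem s2 ''r'' 0 = int (card {k. k < l \<and> rank_before I S y k j})"
        "rmem s2 ''f'' 0 = rmem s ''f'' 0 + of_int (\<Sum>k<l. max 0 (?M j k) * max 0 (?M k j))"
        using inv r keeps_imem[OF k12] keeps_rmem[OF k12] unfolding Inv_def rep_def by simp_all
      have MN: "imem s2 ''M'' 0 = ?M j l" "imem s2 ''N'' 0 = ?M l j" "t \<le> 6 * ?n + 2" "is = []"
        using 8 by auto
      have before: "rank_before I S y l j \<longleftrightarrow> \<not> ?M j l < ?M l j \<and> \<not> (\<not> ?M l j < ?M j l \<and> \<not> l < j)"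
        unfolding rank_before_def by auto
      have prod: "max 0 (?M j l) * max 0 (?M l j) = (if 0 < ?M j l \<and> 0 < ?M l j then ?M j l * ?M l j else 0)"
        by (auto simp: max_def)
      show ?case
        using k2 v MN before
        by (intro wp_intros) (simp_all add: Inv_def keeps_iupd keeps_rupd card prod algebra_simps)
    qed (use r assms l inv in \<open>auto simp: Inv_def\<close>)
  next
    fix t s' assume "Inv ?m s'" "t \<le> ?m * (6 * ?n + 9 + 2) + 2"
    then show "[] = [] \<and> t \<le> ?m * (6 * ?n + 11) + 2 \<and> keeps row_vars s s' \<and>
      imem s' ''r'' 0 = int (position I S y j) \<and>
      rmem s' ''f'' 0 = rmem s ''f'' 0 + of_int (\<Sum>k<?m. max 0 (?M j k) * max 0 (?M k j))"
      unfolding Inv_def position_def by (simp add: add.commute)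
  qed
qed

definition eval_body :: com where
  "eval_body = Seq (iset ''r'' (IConst 0)) (Seq (iset ''K'' (IConst 0)) (Seq row_loop
    (Seq (IAssign ''out'' (var ''r'') (var ''j'')) (iset ''J'' (IAdd (var ''J'') (var ''n''))))))"

definition evaluate :: com where
  "evaluate = Seq (rset ''f'' (ROfInt (IConst 0))) (Seq (iset ''J'' (IConst 0))
    (For ''j'' (var ''m'') eval_body))"

abbreviation eval_vars :: "string set" where
  "eval_vars \<equiv> row_vars \<union> {''j'', ''J'', ''out''}"

text \<open>The permutation is rewritten by every evaluation, including hypothetical ones; the last
  evaluation uses the true outcomes and leaves the answer.\<close>

definition evaluated :: "lfr \<Rightarrow> nat set \<Rightarrow> (nat \<Rightarrow> bool) \<Rightarrow> state \<Rightarrow> bool" where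
  "evaluated I S y s \<longleftrightarrow> rmem s ''f'' 0 = of_int (residual I S y) \<and>
    (\<forall>j<num_funs I. imem s ''out'' (int (position I S y j)) = int j)"

definition eval_time :: "lfr \<Rightarrow> nat" where
  "eval_time I = num_funs I * (num_funs I * (6 * num_vars I + 11) + 8) + 4"

lemma wp_evaluate:
  assumes "rep I S y s"
  shows "wp x evaluate (\<lambda>t is s'. is = [] \<and> t \<le> eval_time I \<and> keeps eval_vars s s' \<and> evaluated I S y s') s"
proof -
  let ?n = "num_vars I" and ?m = "num_funs I" and ?M = "max_diff I S y"
  let ?T = "?m * (6 * ?n + 11) + 6"
  let ?row = "\<lambda>j. \<Sum>k<?m. max 0 (?M j k) * max 0 (?M k j)"
  define Inv where "Inv l s' \<longleftrightarrow> keeps eval_vars s s' \<and> imem s' ''j'' 0 = int l \<and>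
    imem s' ''J'' 0 = int l * int ?n \<and> rmem s' ''f'' 0 = of_int (\<Sum>j<l. ?row j) \<and>
    (\<forall>j<l. imem s' ''out'' (int (position I S y j)) = int j)" for l s'
  have Inv_rep: "rep I S y s'" if "Inv l s'" for l s'
    using that assms unfolding Inv_def by (auto elim!: rep_keeps)
  show ?thesis
    unfolding evaluate_def
  proof (intro wp_intros, rule wp_For[where N = ?m and T = ?T and Inv = Inv])
    show "Inv 0 (iupd ''j'' 0 0 (iupd ''J'' (ival (IConst 0) (rupd ''f'' (ival (IConst 0) s) (rval (ROfInt (IConst 0)) s) s))
       (ival (IConst 0) (rupd ''f'' (ival (IConst 0) s) (rval (ROfInt (IConst 0)) s) s))
       (rupd ''f'' (ival (IConst 0) s) (rval (ROfInt (IConst 0)) s) s)))"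
      by (simp add: Inv_def keeps_iupd keeps_rupd keeps_refl)
  next
    fix l s' assume inv: "Inv l s'"
    then show "imem s' ''j'' 0 = int l \<and> ival (var ''m'') s' = int ?m"
      using Inv_rep[OF inv] by (simp add: Inv_def rep_def)
  next
    fix l s1 assume l: "l < ?m" and inv: "Inv l s1"
    note r = Inv_rep[OF inv]
    show "wp x eval_body (\<lambda>t is s''. is = [] \<and> t \<le> ?T \<and>
        Inv (Suc l) (iupd ''j'' 0 (imem s'' ''j'' 0 + 1) s'')) s1"
      unfolding eval_body_def
    proof (intro wp_intros, rule wp_mono[OF wp_row_loop[where I = I and S = S and y = y and j = l]],
        goal_cases)
      case 1
      show ?case
        using r(1) by (rule rep_keeps[rotated, where V = row_vars]) (auto simp: keeps_def)
    next
      case (7 t "is" s2)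
      have k12: "keeps row_vars s1 s2"
        by (rule keeps_trans[of _ _ "iupd ''K'' 0 0 (iupd ''r'' 0 0 s1)"])
          (use 7 in \<open>auto simp: keeps_iupd keeps_refl\<close>)
      have k2: "keeps eval_vars s s2"
        by (rule keeps_trans[OF _ k12]) (use inv in \<open>auto simp: Inv_def\<close>)
      have v: "imem s2 ''j'' 0 = int l" "imem s2 ''J'' 0 = int l * int ?n" "imem s2 ''n'' 0 = int ?n"
        "imem s2 ''out'' z = imem s1 ''out'' z" for z
        using inv r keeps_imem[OF k12] unfolding Inv_def rep_def by simp_all
      have res: "imem s2 ''r'' 0 = int (position I S y l)" "t \<le> ?m * (6 * ?n + 11) + 2" "is = []"
        "rmem s2 ''f'' 0 = of_int (\<Sum>j<Suc l. ?row j)"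
        using 7 inv unfolding Inv_def by simp_all
      have out: "imem s1 ''out'' (int (position I S y j)) = int j" if "j < l" for j
        using inv that unfolding Inv_def by simp
      \<comment> \<open>Positions are distinct, so the output entry of row \<open>l\<close> does not
        overwrite an earlier one.\<close>
      have inj: "position I S y j \<noteq> position I S y l" if "j < l" for j
        using that l bij_position[of I S y] unfolding bij_betw_def inj_on_def by fastforce
      show ?case
        using k2 v res out inj
        by (intro wp_intros) (auto simp: Inv_def keeps_iupd less_Suc_eq algebra_simps)
    qed (use inv l in \<open>auto simp: Inv_def\<close>)
  next
    fix t s' assume "Inv ?m s'" "t \<le> ?m * (?T + 2) + 2"
    then show "[] @ [] @ [] = [] \<and> 1 + (1 + t) \<le> eval_time I \<and> keeps eval_vars s s' \<and> evaluated I S y s'"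
      unfolding Inv_def eval_time_def evaluated_def residual_def by (simp add: add.commute)
  qed
qed

lemma rep_iupd:
  "v \<notin> {''m'', ''n'', ''a'', ''s'', ''v'', ''p'', ''c''} \<Longrightarrow> rep I S y (iupd v k z s) \<longleftrightarrow> rep I S y s"
  by (rule iffI; rule rep_keeps[where V = "{v}"]) (auto simp: keeps_def)

lemma rep_rupd:
  "v \<notin> {''m'', ''n'', ''a'', ''s'', ''v'', ''p'', ''c''} \<Longrightarrow> rep I S y (rupd v k z s) \<longleftrightarrow> rep I S y s"
  by (rule iffI; rule rep_keeps[where V = "{v}"]) (auto simp: keeps_def)

lemma rep_test:
  assumes "rep I S y s"
  shows "rep I (insert q S) (y(q := b)) (iupd ''v'' (int q) (of_bool b) (iupd ''s'' (int q) 1 s))"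
  unfolding rep_def
proof (intro conjI allI impI)
  fix i assume "i < num_vars I" "i \<in> insert q S"
  then show "imem (iupd ''v'' (int q) (of_bool b) (iupd ''s'' (int q) 1 s)) ''v'' (int i) = of_bool ((y(q := b)) i)"
    using assms by (cases "i = q") (auto simp: rep_def)
qed (use assms in \<open>auto simp: rep_def\<close>)

text \<open>\<open>rep\<close> constrains the array \<open>v\<close> only on tested variables, so a
  hypothetical test is undone by clearing its mark in \<open>s\<close>.\<close>

lemma rep_untest:
  assumes "rep I (insert q S) (y(q := b)) s" "q \<notin> S"
  shows "rep I S y (iupd ''s'' (int q) 0 s)"
  unfolding rep_def
proof (intro conjI allI impI)
  fix i assume i: "i < num_vars I" "i \<in> S"
  then have "imem s ''v'' (int i) = of_bool ((y(q := b)) i)"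
    using assms(1) unfolding rep_def by blast
  then show "imem (iupd ''s'' (int q) 0 s) ''v'' (int i) = of_bool (y i)"
    using assms(2) i by (cases "i = q") auto
qed (use assms in \<open>auto simp: rep_def\<close>)

lemma rep_query:
  assumes "rep I S x s"
  shows "rep I (insert q S) x (iupd ''s'' (int q) 1 (iupd ''v'' (int q) (of_bool (x q)) s))"
  unfolding rep_def
proof (intro conjI allI impI)
  fix i assume "i < num_vars I" "i \<in> insert q S"
  then show "imem (iupd ''s'' (int q) 1 (iupd ''v'' (int q) (of_bool (x q)) s)) ''v'' (int i) = of_bool (x i)"
    using assms by (cases "i = q") (auto simp: rep_def)
qed (use assms in \<open>auto simp: rep_def\<close>)

text \<open>The row-major index decodes by \<open>div\<close> and \<open>mod\<close> because
  \<open>i < n\<close>, and it stays below \<open>m * n\<close>, within the cells that hold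
  input.\<close>

lemma rep_input_state: "rep I {} x (input_state I)"
proof -
  have "(int j * int (num_vars I) + int i < int (num_funs I) * int (num_vars I))
    \<and> nat (int j * int (num_vars I) + int i) div num_vars I = j
    \<and> nat (int j * int (num_vars I) + int i) mod num_vars I = i"
    if "j < num_funs I" "i < num_vars I" for i j
  proof -
    have eq: "int j * int (num_vars I) + int i = int (j * num_vars I + i)" by simp
    have "j * num_vars I + i < Suc j * num_vars I" using that by simp
    also have "\<dots> \<le> num_funs I * num_vars I" using that by (intro mult_right_mono) auto
    finally show ?thesis using that unfolding eq nat_int
      by (simp del: of_nat_add of_nat_mult add: of_nat_mult[symmetric])
  qed
  then show ?thesis unfolding rep_def input_state_def by simp
qed

text \<open>\<open>probe c\<close> evaluates the hypothetical outcome \<open>c\<close> of testing variable \<open>q\<close>.\<close>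

definition probe :: "int \<Rightarrow> com" where
  "probe c = Seq (IAssign ''s'' (var ''q'') (IConst 1)) (Seq (IAssign ''v'' (var ''q'') (IConst c))
    (Seq evaluate (IAssign ''s'' (var ''q'') (IConst 0))))"

lemma wp_probe:
  assumes "rep I S y s" "imem s ''q'' 0 = int q" "q \<notin> S"
  shows "wp x (probe (of_bool b)) (\<lambda>t is s'. is = [] \<and> t \<le> eval_time I + 3 \<and>
    keeps (eval_vars \<union> {''s'', ''v''}) s s' \<and> rep I S y s' \<and>
    rmem s' ''f'' 0 = of_int (residual I (insert q S) (y(q := b)))) s"
proof -
  define s1 where "s1 = iupd ''v'' (int q) (of_bool b) (iupd ''s'' (int q) 1 s)"
  have rep1: "rep I (insert q S) (y(q := b)) s1"
    unfolding s1_def by (rule rep_test[OF assms(1)])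
  have k1: "keeps (eval_vars \<union> {''s'', ''v''}) s s1"
    unfolding s1_def by (simp add: keeps_iupd keeps_refl)
  have tail: "wp x (Seq evaluate (IAssign ''s'' (var ''q'') (IConst 0))) (\<lambda>t is s'. is = [] \<and> t \<le> eval_time I + 1 \<and>
    keeps (eval_vars \<union> {''s'', ''v''}) s s' \<and> rep I S y s' \<and>
    rmem s' ''f'' 0 = of_int (residual I (insert q S) (y(q := b)))) s1"
  proof (rule wp_Seq, rule wp_mono[OF wp_evaluate[OF rep1]], rule wp_IAssign, goal_cases)
    case (1 t "is" s2)
    then have k2: "keeps eval_vars s1 s2" by simp
    have k: "keeps (eval_vars \<union> {''s'', ''v''}) s s2" by (rule keeps_trans[OF k1 k2]) auto
    have rep2: "rep I (insert q S) (y(q := b)) s2" by (rule rep_keeps[OF k2 rep1]) auto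
    have "imem s2 ''q'' 0 = int q" using keeps_imem[OF k, of "''q''"] assms(2) by simp
    then show ?case
      using 1 k rep_untest[OF rep2 assms(3)] by (simp add: keeps_iupd evaluated_def)
  qed
  show ?thesis
    unfolding probe_def
    by (rule wp_Seq, rule wp_IAssign, rule wp_Seq, rule wp_IAssign)
      (simp add: assms(2) s1_def[symmetric], rule wp_mono[OF tail], simp)
qed

section \<open>Greedy selection and the main loop\<close>

definition keep_best :: com where
  "keep_best = Cond (RLess (ROfInt (IConst 0)) (rvar ''g''))
    (Cond (BAnd (BNot (ILess (var ''b'') (IConst 0)))
        (BNot (RLess (RDiv (RCell ''c'' (var ''q'')) (rvar ''g'')) (rvar ''h''))))
      Skip
      (Seq (iset ''b'' (var ''q'')) (rset ''h'' (RDiv (RCell ''c'' (var ''q'')) (rvar ''g'')))))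
    Skip"

definition select_body :: com where
  "select_body = Cond (ILess (IConst 0) (ICell ''s'' (var ''q''))) Skip
    (Seq (probe 1)
    (Seq (rset ''g'' (RMul (RCell ''p'' (var ''q'')) (RSub (rvar ''F'') (rvar ''f''))))
    (Seq (probe 0)
    (Seq (rset ''g'' (RAdd (rvar ''g'')
        (RMul (RSub (ROfInt (IConst 1)) (RCell ''p'' (var ''q''))) (RSub (rvar ''F'') (rvar ''f'')))))
      keep_best))))"

text \<open>The value -1 of \<open>b\<close> stands for \<open>None\<close> in
  \<open>best_below\<close>. Probing overwrites \<open>f\<close>, so the current residual is saved
  in \<open>F\<close>.\<close>

definition select :: com where
  "select = Seq (iset ''b'' (IConst (-1))) (Seq (rset ''F'' (rvar ''f''))
    (For ''q'' (var ''n'') select_body))"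

definition select_time :: "lfr \<Rightarrow> nat" where
  "select_time I = num_vars I * (2 * eval_time I + 15) + 4"

definition main_loop :: com where
  "main_loop = While (RLess (ROfInt (IConst 0)) (rvar ''f''))
    (Seq select (Seq (Query ''v'' (var ''b'') (var ''b''))
      (Seq (IAssign ''s'' (var ''b'') (IConst 1)) evaluate)))"

definition main :: com where
  "main = Seq evaluate main_loop"

context lfr_problem
begin

definition selecting :: "nat set \<Rightarrow> (nat \<Rightarrow> bool) \<Rightarrow> nat \<Rightarrow> state \<Rightarrow> bool" where
  "selecting S y l s \<longleftrightarrow> rep I S y s \<and> rmem s ''F'' 0 = of_int (residual I S y) \<and>
    (case best_below l S y of None \<Rightarrow> imem s ''b'' 0 = - 1
      | Some k \<Rightarrow> imem s ''b'' 0 = int k \<and> rmem s ''h'' 0 = price k S y)"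

lemma selecting_keeps:
  assumes "keeps V s s'" "selecting S y l s" "rep I S y s'" "V \<inter> {''F'', ''b'', ''h''} = {}"
  shows "selecting S y l s'"
proof -
  have "''F'' \<notin> V" "''b'' \<notin> V" "''h'' \<notin> V" using assms(4) by auto
  then show ?thesis using assms(2,3) keeps_imem[OF assms(1)] keeps_rmem[OF assms(1)]
    unfolding selecting_def by (simp split: option.splits)
qed

lemma selecting_iupd: "selecting S y l (iupd ''q'' k z s) \<longleftrightarrow> selecting S y l s"
  by (simp add: selecting_def rep_iupd split: option.splits)

lemma wp_keep_best:
  assumes "selecting S y l s" "imem s ''q'' 0 = int l" "rmem s ''g'' 0 = exp_gain l S y"
    "l < num_vars I" "l \<notin> S"
  shows "wp x keep_best (\<lambda>t is s'. is = [] \<and> t \<le> 4 \<and> selecting S y (Suc l) s' \<and> imem s' ''q'' 0 = int l) s"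
proof -
  have c: "rmem s ''c'' (int l) / exp_gain l S y = price l S y"
    using assms(1,4) unfolding selecting_def rep_def price_def by simp
  show ?thesis
  proof (cases "best_below l S y")
    case None
    then show ?thesis
      unfolding keep_best_def using assms c
      by (intro wp_intros) (simp_all add: selecting_def rep_iupd rep_rupd)
  next
    case (Some k)
    then show ?thesis
      unfolding keep_best_def using assms c
      by (intro wp_intros) (simp_all add: selecting_def rep_iupd rep_rupd)
  qed
qed

lemma wp_select_body:
  assumes "selecting S y l s" "imem s ''q'' 0 = int l" "l < num_vars I"
  shows "wp x select_body (\<lambda>t is s'. is = [] \<and> t \<le> 2 * eval_time I + 13 \<and>
    selecting S y (Suc l) s' \<and> imem s' ''q'' 0 = int l) s"
proof -
  have rep: "rep I S y s" using assms(1) by (simp add: selecting_def)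
  then have tested: "imem s ''s'' (int l) = of_bool (l \<in> S)" using assms(3) by (simp add: rep_def)
  show ?thesis
  proof (cases "l \<in> S")
    case True
    then have "selecting S y (Suc l) s" using assms(1) by (simp add: selecting_def)
    then show ?thesis
      unfolding select_body_def using tested True assms(2)
      by (intro wp_Cond wp_Skip) simp_all
  next
    case False
    show ?thesis
      unfolding select_body_def
    proof (rule wp_Cond, goal_cases)
      case 1
      then show ?case using tested assms(2) False by simp
    next
      case 2
      show ?case
      proof (rule wp_Seq, rule wp_mono[OF wp_probe[OF rep assms(2) False, where b = True, simplified of_bool_eq]],
          rule wp_Seq, rule wp_RAssign, goal_cases)
        case (1 t "is" s1)
        then have k1: "keeps (eval_vars \<union> {''s'', ''v''}) s s1" and rep1: "rep I S y s1"
          and f1: "rmem s1 ''f'' 0 = of_int (residual I (insert l S) (y(l := True)))"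
          and t1: "t \<le> eval_time I + 3" "is = []" by auto
        have sel1: "selecting S y l s1" by (rule selecting_keeps[OF k1 assms(1) rep1]) auto
        have q1: "imem s1 ''q'' 0 = int l" using keeps_imem[OF k1, of "''q''"] assms(2) by simp
        define g where "g = prob_one I l * outcome_gain l True S y"
        define s2 where "s2 = rupd ''g'' 0 g s1"
        have g: "rval (RMul (RCell ''p'' (var ''q'')) (RSub (rvar ''F'') (rvar ''f''))) s1 = g"
          using sel1 q1 f1 assms(3) unfolding selecting_def rep_def g_def outcome_gain_def by simp
        have rep2: "rep I S y s2" and q2: "imem s2 ''q'' 0 = int l"
          using rep1 q1 by (simp_all add: s2_def rep_rupd)
        have sel2: "selecting S y l s2"
          by (rule selecting_keeps[OF _ sel1 rep2, of "{''g''}"]) (auto simp: s2_def keeps_rupd keeps_refl)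
        show ?case
          unfolding g ival.simps s2_def[symmetric]
        proof (rule wp_Seq, rule wp_mono[OF wp_probe[OF rep2 q2 False, where b = False, simplified of_bool_eq]],
            rule wp_Seq, rule wp_RAssign, goal_cases)
          case (1 t' is' s3)
          then have k3: "keeps (eval_vars \<union> {''s'', ''v''}) s2 s3" and rep3: "rep I S y s3"
            and f3: "rmem s3 ''f'' 0 = of_int (residual I (insert l S) (y(l := False)))"
            and t3: "t' \<le> eval_time I + 3" "is' = []" by auto
          have sel3: "selecting S y l s3" by (rule selecting_keeps[OF k3 sel2 rep3]) auto
          have q3: "imem s3 ''q'' 0 = int l" using keeps_imem[OF k3, of "''q''"] q2 by simp
          define s4 where "s4 = rupd ''g'' 0 (exp_gain l S y) s3"
          have g3: "rmem s3 ''g'' 0 = g" using keeps_rmem[OF k3, of "''g''"] by (simp add: s2_def)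
          have g': "rval (RAdd (rvar ''g'')
              (RMul (RSub (ROfInt (IConst 1)) (RCell ''p'' (var ''q''))) (RSub (rvar ''F'') (rvar ''f'')))) s3
              = exp_gain l S y"
            using sel3 q3 f3 g3 assms(3)
            unfolding selecting_def rep_def exp_gain_def g_def outcome_gain_def by simp
          have rep4: "rep I S y s4" and q4: "imem s4 ''q'' 0 = int l" "rmem s4 ''g'' 0 = exp_gain l S y"
            using rep3 q3 by (simp_all add: s4_def rep_rupd)
          have sel4: "selecting S y l s4"
            by (rule selecting_keeps[OF _ sel3 rep4, of "{''g''}"]) (auto simp: s4_def keeps_rupd keeps_refl)
          show ?case
            unfolding g' ival.simps s4_def[symmetric]
            by (rule wp_mono[OF wp_keep_best[OF sel4 q4 assms(3) False]]) (use t1 t3 in simp)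
        qed
      qed
    qed
  qed
qed

lemma wp_select:
  assumes "rep I S y s" "evaluated I S y s" "0 < residual I S y"
  shows "wp x select (\<lambda>t is s'. is = [] \<and> t \<le> select_time I \<and> rep I S y s' \<and>
    imem s' ''b'' 0 = int (best S y)) s"
  unfolding select_def
proof (intro wp_Seq wp_IAssign wp_RAssign, rule wp_For[where N = "num_vars I" and
      T = "2 * eval_time I + 13" and Inv = "\<lambda>l s. selecting S y l s \<and> imem s ''q'' 0 = int l"], goal_cases)
  case 1
  then show ?case using assms by (simp add: selecting_def rep_iupd rep_rupd evaluated_def)
next
  case (2 l s')
  then show ?case by (simp add: selecting_def rep_def)
next
  case (3 l s1)
  then show ?case
    by (intro wp_mono[OF wp_select_body[of S y l s1 x]])
      (simp_all add: selecting_iupd del: best_below.simps)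
next
  case (4 t s')
  \<comment> \<open>The residual is positive, so some variable offers a gain and the scan does not
    end with \<open>None\<close>.\<close>
  obtain k where "best_below (num_vars I) S y = Some k"
    using exp_gain_pos_exists[OF assms(3)] best_below_None[of "num_vars I" S y]
    by (cases "best_below (num_vars I) S y") fastforce+
  then show ?case using 4 by (simp add: selecting_def best_def select_time_def algebra_simps)
qed

text \<open>The loop proceeds in lockstep with \<open>greedy_tests\<close>, by induction on the
  fuel. Besides selection and evaluation, a round takes 3 steps: guard, query and marking.\<close>

lemma exec_main_loop:
  assumes "rep I S x s" "evaluated I S x s" "S \<subseteq> {..<num_vars I}" "num_vars I \<le> card S + f"
  shows "\<exists>t s'. exec x main_loop s t (greedy_tests f S x) s' \<and>
    t \<le> f * (select_time I + eval_time I + 3) + 1 \<and>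
    evaluated I (S \<union> set (greedy_tests f S x)) x s'"
  using assms
proof (induction f arbitrary: S s)
  case 0
  then have "S = {..<num_vars I}" using card_seteq[of "{..<num_vars I}" S] by simp
  then have "residual I S x = 0" using residual_full by simp
  then have "\<not> bval (RLess (ROfInt (IConst 0)) (rvar ''f'')) s"
    using 0 by (simp add: evaluated_def)
  then have "exec x main_loop s 1 [] s" unfolding main_loop_def by (rule exec.WhileFalse)
  then show ?case using 0 by (intro exI[of _ 1] exI[of _ s]) simp
next
  case (Suc f)
  show ?case
  proof (cases "residual I S x = 0")
    case True
    then have "\<not> bval (RLess (ROfInt (IConst 0)) (rvar ''f'')) s"
      using Suc.prems by (simp add: evaluated_def)
    then have "exec x main_loop s 1 [] s" unfolding main_loop_def by (rule exec.WhileFalse)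
    then show ?thesis using Suc.prems True by (intro exI[of _ 1] exI[of _ s]) simp
  next
    case False
    let ?b = "best S x"
    have pos: "0 < residual I S x" using False residual_nonneg[of I S x] by simp
    note b = best(1,2)[OF pos]
    have guard: "bval (RLess (ROfInt (IConst 0)) (rvar ''f'')) s"
      using Suc.prems(2) pos by (simp add: evaluated_def)
    have "wp x (Seq select (Seq (Query ''v'' (var ''b'') (var ''b''))
        (Seq (IAssign ''s'' (var ''b'') (IConst 1)) evaluate)))
      (\<lambda>t is s'. is = [?b] \<and> t \<le> select_time I + eval_time I + 2 \<and>
        rep I (insert ?b S) x s' \<and> evaluated I (insert ?b S) x s') s"
    proof (rule wp_Seq, rule wp_mono[OF wp_select[OF Suc.prems(1,2) pos]], rule wp_Seq,
        rule wp_Query[where i = ?b], goal_cases)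
      case (1 t "is" s1)
      then show ?case by simp
    next
      case (2 t "is" s1)
      define s2 where "s2 = iupd ''s'' (int ?b) 1 (iupd ''v'' (int ?b) (of_bool (x ?b)) s1)"
      have rep2: "rep I (insert ?b S) x s2"
        unfolding s2_def using 2 by (intro rep_query) simp
      have b1: "imem s1 ''b'' 0 = int ?b" using 2 by simp
      have s2: "iupd ''s'' (ival (var ''b'') (iupd ''v'' (ival (var ''b'') s1) (of_bool (x ?b)) s1))
          (ival (IConst 1) (iupd ''v'' (ival (var ''b'') s1) (of_bool (x ?b)) s1))
          (iupd ''v'' (ival (var ''b'') s1) (of_bool (x ?b)) s1) = s2"
        unfolding s2_def using b1 by simp
      show ?case
      proof (rule wp_Seq, rule wp_IAssign, unfold s2, rule wp_mono[OF wp_evaluate[OF rep2]], goal_cases)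
        case *: (1 t' is' s3)
        have "rep I (insert ?b S) x s3"
          by (rule rep_keeps[OF _ rep2, of eval_vars]) (use * in auto)
        then show ?case using * 2 by simp
      qed
    qed
    then obtain t s1 where t: "exec x (Seq select (Seq (Query ''v'' (var ''b'') (var ''b''))
        (Seq (IAssign ''s'' (var ''b'') (IConst 1)) evaluate))) s t [?b] s1"
      "t \<le> select_time I + eval_time I + 2" "rep I (insert ?b S) x s1" "evaluated I (insert ?b S) x s1"
      unfolding wp_def by blast
    have "card (insert ?b S) = Suc (card S)"
      using b finite_subset[OF Suc.prems(3)] by simp
    then obtain t2 s2 where t2: "exec x main_loop s1 t2 (greedy_tests f (insert ?b S) x) s2"
      "t2 \<le> f * (select_time I + eval_time I + 3) + 1"
      "evaluated I (insert ?b S \<union> set (greedy_tests f (insert ?b S) x)) x s2"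
      using Suc.IH[OF t(3,4)] Suc.prems(3,4) b by auto
    have "exec x main_loop s (t + t2 + 1) ([?b] @ greedy_tests f (insert ?b S) x) s2"
      unfolding main_loop_def
      using exec.WhileTrue[OF guard t(1) t2(1)[unfolded main_loop_def]] .
    then show ?thesis
      using False t(2) t2(2,3) by (intro exI[of _ "t + t2 + 1"] exI[of _ s2]) simp
  qed
qed

lemma output_of_evaluated:
  assumes "evaluated I S x s"
  shows "output_of I s = map int (ranking I S x)"
proof -
  have "imem s ''out'' (int r) = int (inv_into {..<num_funs I} (position I S x) r)"
    if "r < num_funs I" for r
  proof -
    let ?j = "inv_into {..<num_funs I} (position I S x) r"
    have "position I S x ?j = r" "?j < num_funs I"
      using that bij_betw_inv_into_right[OF bij_position, of r I S x]
        bij_betwE[OF bij_betw_inv_into[OF bij_position[of I S x]]] by auto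
    then show ?thesis using assms unfolding evaluated_def by metis
  qed
  then show ?thesis unfolding output_of_def ranking_def by simp
qed

lemma runs_strategy_greedy:
  "runs_strategy main I greedy
    (eval_time I + num_vars I * (select_time I + eval_time I + 3) + 1)"
  unfolding runs_strategy_def
proof
  fix x
  have rep0: "rep I {} x (input_state I)" by (rule rep_input_state)
  obtain t s where t: "exec x evaluate (input_state I) t [] s" "t \<le> eval_time I"
    "keeps eval_vars (input_state I) s" "evaluated I {} x s"
    using wp_evaluate[OF rep0, of x] unfolding wp_def by blast
  have "rep I {} x s" by (rule rep_keeps[OF t(3) rep0]) auto
  then obtain t' s' where t': "exec x main_loop s t' (greedy_tests (num_vars I) {} x) s'"
    "t' \<le> num_vars I * (select_time I + eval_time I + 3) + 1"
    "evaluated I (set (greedy_tests (num_vars I) {} x)) x s'"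
    using exec_main_loop[of "{}" x s "num_vars I"] t(4) by auto
  have "exec x main (input_state I) (t + t') (tests greedy x) s'"
    unfolding main_def using exec.Seq[OF t(1) t'(1)] greedy_strategy_path[of "{}"] by simp
  moreover have "output_of I s' = map int (answer greedy x)"
    using output_of_evaluated[OF t'(3)] greedy_strategy_path[of "{}"] by simp
  ultimately show "\<exists>t s. exec x main (input_state I) t (tests greedy x) s \<and>
      output_of I s = map int (answer greedy x) \<and>
      t \<le> eval_time I + num_vars I * (select_time I + eval_time I + 3) + 1"
    using t(2) t'(2) by (intro exI[of _ "t + t'"] exI[of _ s']) simp
qed

end

text \<open>With \<open>B\<close> the sum of the parameters, an evaluation is cubic in
  \<open>B\<close>, a selection makes two evaluations per untested variable, and there are at most
  \<open>n\<close> rounds, which gives degree 5.\<close>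

lemma run_time_le:
  assumes "1 \<le> num_funs I"
  shows "eval_time I + num_vars I * (select_time I + eval_time I + 3) + 1
    \<le> 200 * (num_funs I + num_vars I + D_max I) ^ 5"
proof -
  define B where "B = num_funs I + num_vars I + D_max I"
  have B: "1 \<le> B" "num_funs I \<le> B" "num_vars I \<le> B" using assms by (auto simp: B_def)
  have pw: "1 \<le> B ^ k" for k using B(1) by (rule one_le_power)
  have P: "B * (25 * B\<^sup>2) = 25 * B ^ 3" "B * (73 * B ^ 3) = 73 * B ^ 4" "B * (109 * B ^ 4) = 109 * B ^ 5"
    "B * (17 * B) = 17 * B\<^sup>2"
    using power_Suc[of B 2] power_Suc[of B 3] power_Suc[of B 4] by (simp_all add: power2_eq_square)
  have "num_funs I * (6 * num_vars I + 11) \<le> B * (17 * B)"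
    using B by (intro mult_mono) auto
  then have "num_funs I * (6 * num_vars I + 11) + 8 \<le> 25 * B\<^sup>2"
    using pw[of 2] P(4) by linarith
  then have "num_funs I * (num_funs I * (6 * num_vars I + 11) + 8) \<le> B * (25 * B\<^sup>2)"
    using B by (intro mult_mono) auto
  then have E: "eval_time I \<le> 29 * B ^ 3"
    unfolding eval_time_def using pw[of 3] P by linarith
  have "num_vars I * (2 * eval_time I + 15) \<le> B * (73 * B ^ 3)"
    by (intro mult_mono B) (use E pw[of 3] in linarith)+
  then have S: "select_time I \<le> 77 * B ^ 4"
    unfolding select_time_def using pw[of 4] P by linarith
  have 34: "B ^ 3 \<le> B ^ 4" "B ^ 4 \<le> B ^ 5" using B(1) by (simp_all add: power_increasing)
  have "num_vars I * (select_time I + eval_time I + 3) \<le> B * (109 * B ^ 4)"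
    by (intro mult_mono B) (use E S 34 pw[of 4] in linarith)+
  then have "num_vars I * (select_time I + eval_time I + 3) \<le> 109 * B ^ 5"
    using P by linarith
  \<comment> \<open>The coefficients add up to \<open>29 + 109 + 1 = 139\<close>, within
    200.\<close>
  then show ?thesis
    using E 34 pw[of 5] unfolding B_def[symmetric] by linarith
qed

theorem theorem8:
  "\<exists>(P :: com) (K :: nat) (k :: nat) (C :: real). \<forall>I. lfr_instance I \<longrightarrow>
     (\<exists>S. ranking_strategy I S \<and>
          runs_strategy P I S (K * (num_funs I + num_vars I + D_max I) ^ k) \<and>
          expected_cost I S \<le> C * ln (real (num_funs I * D_max I)) * opt_cost I)"
proof (rule exI[of _ main], rule exI[of _ 200], rule exI[of _ 5], rule exI[of _ 8], intro allI impI)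
  fix I assume inst: "lfr_instance I"
  then interpret lfr_problem I by unfold_locales
  have "runs_strategy main I greedy (200 * (num_funs I + num_vars I + D_max I) ^ 5)"
    using runs_strategy_greedy run_time_le[of I] inst
    unfolding runs_strategy_def lfr_instance_def by (meson order_trans)
  then show "\<exists>S. ranking_strategy I S \<and>
      runs_strategy main I S (200 * (num_funs I + num_vars I + D_max I) ^ 5) \<and>
      expected_cost I S \<le> 8 * ln (real (num_funs I * D_max I)) * opt_cost I"
    using ranking_strategy_greedy expected_cost_greedy_le_opt by blast
qed

end
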